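(* Let $(\Omega,\mathcal A,\mu)$ be a $\sigma$-finite measure space. Let $K$ be a random compact set in $\mathbb C^n$ taking at most countably many different values, with $K(\omega)=\widehat{K(\omega)}$ (polynomially convex) for all $\omega$, and let $\varepsilon:\Omega\to(0,\infty)$ be measurable. Let $f$ be a generalized random function such that, for each $\omega$, $f(\omega,\cdot)$ is holomorphic in a neighbourhood of $K(\omega)$. Then there exists a generalized random polynomial $p$ such that $\|p(\omega,\cdot)-f(\omega,\cdot)\|_{K(\omega)}<\varepsilon(\omega)$ for all $\omega$ outside a set $L\subset\Omega$ with $\mu(L)=0$.
   Context: A random compact set is a measurable map $K$ from $\Omega$ to the space of non-empty compact subsets of $\mathbb C^n$ with the Hausdorff distance and its Borel $\sigma$-algebra. $\widehat L=\{z:|q(z)|\le\max_L|q| \text{ for all polynomials } q\}$. Let $\operatorname{Gr}K=\{(\omega,z):z\in K(\omega)\}$ and $K^{-1}(z)=\{\omega:z\in K(\omega)\}$. A generalized random function is $f:\operatorname{Gr}K\to\mathbb C$ such that for each $z$ with $K^{-1}(z)\ne\emptyset$, $f(\cdot,z)$ is measurable on $K^{-1}(z)$; "$f(\omega,\cdot)$ holomorphic in a neighbourhood of $K(\omega)$" means it is the restriction of a function holomorphic on a neighbourhood. A generalized random polynomial is a generalized random function $p$ such that each $p(\omega,\cdot)$ is (the restriction to $K(\omega)$ of) a polynomial on $\mathbb C^n$. $\|g\|_L=\sup_L|g|$. *)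

theory Defs
  imports "HOL-Analysis.Analysis" "HOL-Probability.Probability"
begin

definition hausdorff_dist :: "'a::metric_space set \<Rightarrow> 'a set \<Rightarrow> real" where
  "hausdorff_dist S T = max (SUP x\<in>S. infdist x T) (SUP y\<in>T. infdist y S)"

definition compact_sets :: "'a::metric_space set set" where
  "compact_sets = {S. compact S \<and> S \<noteq> {}}"

definition hausdorff_open :: "'a::metric_space set set \<Rightarrow> bool" where
  "hausdorff_open U \<longleftrightarrow> U \<subseteq> compact_sets \<and>
     (\<forall>S\<in>U. \<exists>e>0. \<forall>T\<in>compact_sets. hausdorff_dist S T < e \<longrightarrow> T \<in> U)"

definition compact_sets_borel :: "'a::metric_space set measure" where
  "compact_sets_borel = sigma compact_sets {U. hausdorff_open U}"

definition polyfun_cn :: "(complex^'n \<Rightarrow> complex) \<Rightarrow> bool" where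
  "polyfun_cn q \<longleftrightarrow> (\<exists>c :: ('n \<Rightarrow> nat) \<Rightarrow> complex. finite {\<alpha>. c \<alpha> \<noteq> 0} \<and>
     (\<forall>z. q z = (\<Sum>\<alpha>\<in>{\<alpha>. c \<alpha> \<noteq> 0}. c \<alpha> * (\<Prod>i\<in>UNIV. (z $ i) ^ (\<alpha> i)))))"

definition poly_hull :: "(complex^'n) set \<Rightarrow> (complex^'n) set" where
  "poly_hull L = {z. \<forall>q. polyfun_cn q \<longrightarrow> norm (q z) \<le> (SUP w\<in>L. norm (q w))}"

definition holomorphic_cn :: "(complex^'n \<Rightarrow> complex) \<Rightarrow> (complex^'n) set \<Rightarrow> bool" where
  "holomorphic_cn g U \<longleftrightarrow> (\<forall>z\<in>U. \<exists>D. (g has_derivative D) (at z) \<and>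
      (\<forall>c v. D (\<chi> i. c * v $ i) = c * D v))"

definition holomorphic_near :: "(complex^'n \<Rightarrow> complex) \<Rightarrow> (complex^'n) set \<Rightarrow> bool" where
  "holomorphic_near g S \<longleftrightarrow> (\<exists>U h. open U \<and> S \<subseteq> U \<and> holomorphic_cn h U \<and> (\<forall>z\<in>S. g z = h z))"

definition preimg :: "'a measure \<Rightarrow> ('a \<Rightarrow> 'b set) \<Rightarrow> 'b \<Rightarrow> 'a set" where
  "preimg M K z = {\<omega>\<in>space M. z \<in> K \<omega>}"

(* generalized random function on Gr K (values outside the graph are irrelevant) *)
definition gen_random_fun :: "'a measure \<Rightarrow> ('a \<Rightarrow> 'b set) \<Rightarrow> ('a \<Rightarrow> 'b \<Rightarrow> complex) \<Rightarrow> bool" where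
  "gen_random_fun M K f \<longleftrightarrow> (\<forall>z. preimg M K z \<noteq> {} \<longrightarrow>
      (\<lambda>\<omega>. f \<omega> z) \<in> borel_measurable (restrict_space M (preimg M K z)))"

definition gen_random_poly :: "'a measure \<Rightarrow> ('a \<Rightarrow> (complex^'n) set) \<Rightarrow> ('a \<Rightarrow> complex^'n \<Rightarrow> complex) \<Rightarrow> bool" where
  "gen_random_poly M K p \<longleftrightarrow> gen_random_fun M K p \<and>
      (\<forall>\<omega>\<in>space M. \<exists>q. polyfun_cn q \<and> (\<forall>z\<in>K \<omega>. p \<omega> z = q z))"

end

theory Submission
  imports Defs "HOL-Complex_Analysis.Complex_Analysis"
begin

text \<open>
  For a single value of \<open>K\<close> the claim is the Oka--Weil theorem, and the argument is Oka's.
  A polynomially convex compact set has a polynomial polyhedron between itself and any neighbourhood.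
  Lifting a polyhedron to the graph of one of its defining polynomials \<open>q\<close> replaces the constraint
  \<open>|q| \<le> 1\<close> by a further disc variable \<open>w\<close>, so it suffices to extend \<open>f\<close> from the graph \<open>w = q(x)\<close>
  to the larger polyhedron; iterating, one arrives at a polydisc, where Taylor polynomials approximate.
  The extension exists trivially on small boxes, and the local extensions are merged across real
  hyperplanes: two of them differ by a multiple of \<open>w - q\<close>, and the quotient is split additively
  into parts holomorphic on either side. On polydiscs this splitting is Cauchy's integral formula for
  a thin rectangle, and the extension theorem itself propagates it to polyhedra with more constraints.

  For the random statement fix a sequence \<open>P\<close> of polynomials that is dense on every compact set, and
  let \<open>N(\<omega>)\<close> be the least index that is good on a countable dense subset of \<open>K(\<omega>)\<close>; as \<open>K\<close> has
  countably many values, \<open>N\<close> is measurable.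
\<close>

text \<open>The obstacle is a circle: extending from a graph needs the splitting, and splitting
  under a constraint \<open>q\<close> needs an extension from the graph of \<open>q\<close>. It is
  broken by counting constraints only: extension and splitting for \<open>q # Q\<close> both rest on
  \<open>map shift Q\<close>, which has one constraint fewer but one variable more. Hence splitting
  has to be stated for all compact convex factors, coordinates and directions at once, and every
  function comes with an open neighbourhood that may shrink. Oka--Weil is applied for each \<omega>
  separately and says nothing about the dependence on \<omega>; it only ensures that the search for
  an index succeeds. Measurability cannot be tested directly on a dense subset of
  \<open>K \<omega>\<close> that moves with \<omega>, because \<open>f\<close> is measurable in
  \<omega> only for fixed \<open>z\<close>. On the event that \<open>K\<close> equals a fixed
  \<open>S\<close> the test points are fixed and all belong to \<open>K \<omega>\<close>; such an
  event is measurable because singletons are Borel for the Hausdorff distance.\<close>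

section \<open>Holomorphic functions of countably many variables\<close>

text \<open>All dimensions live in one space of sequences, so that variables can be added in an induction.
  Testing holomorphy along holomorphic curves makes it stable under composition at once.\<close>

definition hol :: "((nat \<Rightarrow> complex) \<Rightarrow> complex) \<Rightarrow> (nat \<Rightarrow> complex) set \<Rightarrow> bool" where
  "hol f U \<longleftrightarrow> continuous_on U f \<and>
     (\<forall>\<phi> T. open T \<and> \<phi> ` T \<subseteq> U \<and> (\<forall>i. (\<lambda>t. \<phi> t i) holomorphic_on T) \<longrightarrow>
        (\<lambda>t. f (\<phi> t)) holomorphic_on T)"

lemma holD: "hol f U \<Longrightarrow> open T \<Longrightarrow> \<phi> ` T \<subseteq> U \<Longrightarrow> (\<And>i. (\<lambda>t. \<phi> t i) holomorphic_on T)
    \<Longrightarrow> (\<lambda>t. f (\<phi> t)) holomorphic_on T"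
  unfolding hol_def by blast

lemma hol_continuous: "hol f U \<Longrightarrow> continuous_on U f"
  unfolding hol_def by blast

lemma hol_subset: "hol f U \<Longrightarrow> V \<subseteq> U \<Longrightarrow> hol f V"
  unfolding hol_def by (blast intro: continuous_on_subset)

lemma hol_empty [simp]: "hol f {}"
  by (simp add: hol_def holomorphic_on_def)

lemma hol_const [simp]: "hol (\<lambda>x. c) U"
  by (auto simp: hol_def)

lemma hol_coord [simp]: "hol (\<lambda>x. x i) U"
  unfolding hol_def
proof (intro conjI allI impI)
  show "continuous_on U (\<lambda>x::nat \<Rightarrow> complex. x i)"
    by (rule continuous_on_subset[OF continuous_on_product_coordinates subset_UNIV])
qed simp

lemma hol_add: "hol f U \<Longrightarrow> hol g U \<Longrightarrow> hol (\<lambda>x. f x + g x) U"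
  unfolding hol_def by (intro conjI allI impI continuous_intros holomorphic_intros; blast)

lemma hol_diff: "hol f U \<Longrightarrow> hol g U \<Longrightarrow> hol (\<lambda>x. f x - g x) U"
  unfolding hol_def by (intro conjI allI impI continuous_intros holomorphic_intros; blast)

lemma hol_uminus: "hol f U \<Longrightarrow> hol (\<lambda>x. - f x) U"
  unfolding hol_def by (intro conjI allI impI continuous_intros holomorphic_intros; blast)

lemma hol_mult: "hol f U \<Longrightarrow> hol g U \<Longrightarrow> hol (\<lambda>x. f x * g x) U"
  unfolding hol_def by (intro conjI allI impI continuous_intros holomorphic_intros; blast)

lemma hol_divide:
  assumes "hol f U" "hol g U" "\<And>x. x \<in> U \<Longrightarrow> g x \<noteq> 0"
  shows "hol (\<lambda>x. f x / g x) U"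
  unfolding hol_def
proof (intro conjI allI impI)
  show "continuous_on U (\<lambda>x. f x / g x)"
    using assms by (intro continuous_on_divide hol_continuous) auto
next
  fix \<phi> T assume *: "open T \<and> \<phi> ` T \<subseteq> U \<and> (\<forall>i. (\<lambda>t. \<phi> t i) holomorphic_on T)"
  show "(\<lambda>t. f (\<phi> t) / g (\<phi> t)) holomorphic_on T"
    using * assms(3) by (intro holomorphic_on_divide holD[OF assms(1)] holD[OF assms(2)]) auto
qed

lemma hol_cong: "hol f U \<Longrightarrow> (\<And>x. x \<in> U \<Longrightarrow> f x = g x) \<Longrightarrow> hol g U"
  unfolding hol_def
proof (intro conjI allI impI, goal_cases)
  case 1
  then show ?case using continuous_on_cong[of U U f g] by simp
next
  case (2 \<phi> T)
  then have "(\<lambda>t. f (\<phi> t)) holomorphic_on T" by blast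
  then show ?case by (rule holomorphic_transform) (use 2 in blast)
qed

lemma hol_compose:
  assumes "hol f U" "\<And>i. hol (\<lambda>x. \<psi> x i) V" "\<psi> ` V \<subseteq> U"
  shows "hol (\<lambda>x. f (\<psi> x)) V"
  unfolding hol_def
proof (intro conjI allI impI)
  have "continuous_on V \<psi>"
    using assms(2) by (intro continuous_on_coordinatewise_then_product) (auto simp: hol_def)
  then show "continuous_on V (\<lambda>x. f (\<psi> x))"
    using continuous_on_compose2[OF hol_continuous[OF assms(1)]] assms(3) by simp
next
  fix \<phi> T assume *: "open T \<and> \<phi> ` T \<subseteq> V \<and> (\<forall>i. (\<lambda>t. \<phi> t i) holomorphic_on T)"
  have "(\<lambda>t. \<psi> (\<phi> t) i) holomorphic_on T" for i
    using * by (intro holD[OF assms(2)]) auto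
  moreover have "(\<lambda>t. \<psi> (\<phi> t)) ` T \<subseteq> U"
    using * assms(3) by blast
  ultimately show "(\<lambda>t. f (\<psi> (\<phi> t))) holomorphic_on T"
    using * by (intro holD[OF assms(1)]) auto
qed

text \<open>Meant for functions defined by cases, whose holomorphy is known only on the pieces of an
  open cover: near \<open>t\<close> the curve stays in the piece around
  \<open>\<phi> t\<close>.\<close>

lemma hol_local:
  assumes "\<And>x. x \<in> U \<Longrightarrow> \<exists>V. open V \<and> x \<in> V \<and> hol f V"
  shows "hol f U"
  unfolding hol_def
proof (intro conjI allI impI)
  obtain V where V: "\<And>x. x \<in> U \<Longrightarrow> open (V x)" "\<And>x. x \<in> U \<Longrightarrow> x \<in> V x" "\<And>x. x \<in> U \<Longrightarrow> hol f (V x)"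
    using assms by metis
  show "continuous_on U f"
    unfolding continuous_on_eq_continuous_within
  proof
    fix x assume x: "x \<in> U"
    have "isCont f x" using hol_continuous[OF V(3)[OF x]] V(1,2)[OF x]
      by (simp add: continuous_on_eq_continuous_at)
    then show "continuous (at x within U) f" by (rule continuous_at_imp_continuous_at_within)
  qed
  fix \<phi> T assume *: "open T \<and> \<phi> ` T \<subseteq> U \<and> (\<forall>i. (\<lambda>t. \<phi> t i) holomorphic_on T)"
  then have c: "continuous_on T \<phi>"
    by (intro continuous_on_coordinatewise_then_product holomorphic_on_imp_continuous_on) auto
  show "(\<lambda>t. f (\<phi> t)) holomorphic_on T"
    unfolding holomorphic_on_def
  proof
    fix t assume t: "t \<in> T"
    then have tU: "\<phi> t \<in> U" using * by auto
    define S where "S = T \<inter> \<phi> -` V (\<phi> t)"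
    have S: "open S" unfolding S_def
      using c * V(1)[OF tU] by (auto simp: continuous_on_open_vimage Int_commute)
    have "(\<lambda>t. f (\<phi> t)) holomorphic_on S"
      using * by (intro holD[OF V(3)[OF tU] S]) (auto simp: S_def intro: holomorphic_on_subset)
    moreover have "t \<in> S" using t V(2)[OF tU] by (auto simp: S_def)
    ultimately show "(\<lambda>t. f (\<phi> t)) field_differentiable at t within T"
      using S by (meson field_differentiable_at_within holomorphic_on_imp_differentiable_at)
  qed
qed

section \<open>Integrals that depend holomorphically on a parameter\<close>

lemma contour_integral_linepath_integral:
  "contour_integral (linepath a b) f = integral {0..1} (\<lambda>u. f (linepath a b u) * (b - a))"
  by (simp add: contour_integral_integral)

text \<open>Morera's theorem: joint continuity allows the integral over a triangle to be exchanged
  with the one over \<open>s\<close>, and the inner triangle integrals vanish by Cauchy's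
  theorem.\<close>

lemma holomorphic_on_integral:
  fixes H :: "complex \<Rightarrow> real \<Rightarrow> complex"
  assumes T: "open T" and c: "continuous_on (T \<times> {0..1}) (\<lambda>(t,s). H t s)"
    and h: "\<And>s. s \<in> {0..1} \<Longrightarrow> (\<lambda>t. H t s) holomorphic_on T"
  shows "(\<lambda>t. integral {0..1} (H t)) holomorphic_on T"
proof (rule analytic_imp_holomorphic, rule Morera_triangle[OF _ T], goal_cases)
  case 1
  show ?case using integral_continuous_on_param[of T 0 1 H] c by simp
next
  case (2 a b d)
  \<comment> \<open>The second conjunct gives the integrability in \<open>s\<close> needed to add
    the three sides under one integral.\<close>
  have swap: "contour_integral (linepath p q) (\<lambda>t. integral {0..1} (H t)) =
      integral {0..1} (\<lambda>s. contour_integral (linepath p q) (\<lambda>t. H t s))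
     \<and> (\<lambda>s. contour_integral (linepath p q) (\<lambda>t. H t s)) integrable_on {0..1}"
    if pq: "closed_segment p q \<subseteq> T" for p q
  proof -
    have lp: "linepath p q u \<in> T" if "u \<in> {0..1}" for u
      using pq that by (metis linepath_in_path path_image_linepath subsetD)
    have c1: "continuous_on ({0..1} \<times> {0..1}) (\<lambda>(u,s). H (linepath p q u) s * (q - p))"
    proof -
      have "continuous_on ({0..1} \<times> {0..1}) (\<lambda>x. (\<lambda>(t,s). H t s) (linepath p q (fst x), snd x))"
        by (rule continuous_on_compose2[OF c])
          (use lp in \<open>auto intro!: continuous_intros simp: linepath_def\<close>)
      then show ?thesis by (auto simp: case_prod_beta intro: continuous_intros)
    qed
    have c2: "continuous_on ({0..1} \<times> {0..1}) (\<lambda>(s,u). H (linepath p q u) s * (q - p))"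
    proof -
      have "continuous_on ({0..1} \<times> {0..1}) (\<lambda>x. (\<lambda>(u,s). H (linepath p q u) s * (q - p)) (snd x, fst x))"
        by (rule continuous_on_compose2[OF c1]) (auto intro!: continuous_intros)
      then show ?thesis by (auto simp: case_prod_beta)
    qed
    have sw: "integral {0..1} (\<lambda>u. integral {0..1} (\<lambda>s. H (linepath p q u) s * (q - p))) =
       integral {0..1} (\<lambda>s. integral {0..1} (\<lambda>u. H (linepath p q u) s * (q - p)))"
      using integral_swap_continuous[of 0 0 1 1 "\<lambda>u s. H (linepath p q u) s * (q - p)"] c1
      by (simp add: cbox_Pair_eq)
    have "continuous_on {0..1} (\<lambda>s. integral {0..1} (\<lambda>u. H (linepath p q u) s * (q - p)))"
      using integral_continuous_on_param[of "{0..1}" 0 1 "\<lambda>s u. H (linepath p q u) s * (q - p)"] c2 by simp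
    then have "(\<lambda>s. integral {0..1} (\<lambda>u. H (linepath p q u) s * (q - p))) integrable_on {0..1}"
      by (rule integrable_continuous_real)
    then show ?thesis using sw
      by (simp add: contour_integral_linepath_integral)
  qed
  show ?case
  proof
    assume sub: "convex hull {a,b,d} \<subseteq> T"
    have seg: "closed_segment a b \<subseteq> T" "closed_segment b d \<subseteq> T" "closed_segment d a \<subseteq> T"
      unfolding segment_convex_hull
      by (rule order_trans[OF hull_mono sub], blast)+
    have z: "contour_integral (linepath a b) (\<lambda>t. H t s) + contour_integral (linepath b d) (\<lambda>t. H t s)
       + contour_integral (linepath d a) (\<lambda>t. H t s) = 0" if "s \<in> {0..1}" for s
    proof -
      have hs: "(\<lambda>t. H t s) holomorphic_on T" by (rule h[OF that])
      then have ci: "(\<lambda>t. H t s) contour_integrable_on linepath p q" if "closed_segment p q \<subseteq> T" for p q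
        using that by (meson contour_integrable_continuous_linepath continuous_on_subset holomorphic_on_imp_continuous_on)
      have "((\<lambda>t. H t s) has_contour_integral 0) (linepath a b +++ linepath b d +++ linepath d a)"
        by (rule Cauchy_theorem_triangle) (rule holomorphic_on_subset[OF hs sub])
      then have "contour_integral (linepath a b +++ linepath b d +++ linepath d a) (\<lambda>t. H t s) = 0"
        by (rule contour_integral_unique)
      then show ?thesis using ci seg by (simp add: add.assoc)
    qed
    show "contour_integral (linepath a b) (\<lambda>t. integral {0..1} (H t)) +
       contour_integral (linepath b d) (\<lambda>t. integral {0..1} (H t)) +
       contour_integral (linepath d a) (\<lambda>t. integral {0..1} (H t)) = 0"
      using swap[OF seg(1)] swap[OF seg(2)] swap[OF seg(3)]
      apply (simp flip: integral_add add: integrable_add)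
      apply (subst integral_cong[where g="\<lambda>_. 0"])
      using z by auto
  qed
qed

lemma hol_integral:
  assumes c: "continuous_on (N \<times> {0..1}) (\<lambda>(x,s). G x s)"
    and h: "\<And>s. s \<in> {0..1} \<Longrightarrow> hol (\<lambda>x. G x s) N"
  shows "hol (\<lambda>x. integral {0..1::real} (G x)) N"
  unfolding hol_def
proof (intro conjI allI impI)
  show "continuous_on N (\<lambda>x. integral {0..1::real} (G x))"
    using integral_continuous_on_param[of N 0 1 G] c by simp
  fix \<phi> T assume *: "open T \<and> \<phi> ` T \<subseteq> N \<and> (\<forall>i. (\<lambda>t. \<phi> t i) holomorphic_on T)"
  then have cp: "continuous_on T \<phi>"
    by (intro continuous_on_coordinatewise_then_product holomorphic_on_imp_continuous_on) auto
  show "(\<lambda>t. integral {0..1} (G (\<phi> t))) holomorphic_on T"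
  proof (rule holomorphic_on_integral)
    have "continuous_on (T \<times> {0..1}) (\<lambda>x. (\<lambda>(t,s). G t s) (\<phi> (fst x), snd x))"
      using * by (intro continuous_on_compose2[OF c] continuous_intros continuous_on_compose2[OF cp]) auto
    then show "continuous_on (T \<times> {0..1}) (\<lambda>(t, s). G (\<phi> t) s)"
      by (simp add: case_prod_beta)
  qed (use * in \<open>auto intro: holD[OF h]\<close>)
qed

text \<open>The derivative of the path has to be continuous on all of \<open>{0..1}\<close>, as it
  is for segments and circles but not at the corners of a polygon; contours with corners are
  therefore treated side by side.\<close>

lemma hol_contour_integral:
  assumes \<gamma>: "path \<gamma>" and d: "continuous_on {0..1} (\<lambda>s. vector_derivative \<gamma> (at s))"
    and c: "continuous_on (N \<times> path_image \<gamma>) (\<lambda>(x,\<zeta>). H x \<zeta>)"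
    and h: "\<And>\<zeta>. \<zeta> \<in> path_image \<gamma> \<Longrightarrow> hol (\<lambda>x. H x \<zeta>) N"
  shows "hol (\<lambda>x. contour_integral \<gamma> (H x)) N"
  unfolding contour_integral_integral
proof (rule hol_integral)
  have "continuous_on (N \<times> {0..1::real}) (\<lambda>p. \<gamma> (snd p))"
    by (rule continuous_on_compose2[OF \<gamma>[unfolded path_def]]) (auto intro!: continuous_intros)
  then have "continuous_on (N \<times> {0..1}) (\<lambda>p. (fst p, \<gamma> (snd p)))"
    by (intro continuous_on_Pair continuous_on_fst continuous_on_id)
  then have "continuous_on (N \<times> {0..1}) (\<lambda>p. (\<lambda>(x,\<zeta>). H x \<zeta>) (fst p, \<gamma> (snd p)))"
    by (rule continuous_on_compose2[OF c]) (auto simp: path_image_def)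
  moreover have "continuous_on (N \<times> {0..1::real}) (\<lambda>p. vector_derivative \<gamma> (at (snd p)))"
    by (rule continuous_on_compose2[OF d]) (auto intro!: continuous_intros)
  ultimately show "continuous_on (N \<times> {0..1}) (\<lambda>(x, s). H x (\<gamma> s) * vector_derivative \<gamma> (at s))"
    unfolding case_prod_beta by (intro continuous_on_mult) auto
qed (auto intro!: hol_mult h simp: path_image_def)

section \<open>Additive splitting across a hyperplane\<close>

text \<open>Two kinds of constraints are kept apart: the factors \<open>B i\<close> are cut by
  hyperplanes and merged again, while the functions in the list are removed one at a time in
  exchange for a new coordinate.\<close>

definition polyh :: "(nat \<Rightarrow> complex set) \<Rightarrow> ((nat \<Rightarrow> complex) \<Rightarrow> complex) list \<Rightarrow> (nat \<Rightarrow> complex) set" where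
  "polyh B Q = {x. (\<forall>i. x i \<in> B i) \<and> (\<forall>q\<in>set Q. norm (q x) \<le> 1)}"

lemma compact_product:
  fixes B :: "nat \<Rightarrow> 'a::topological_space set"
  assumes "\<And>i. compact (B i)"
  shows "compact {x. \<forall>i. x i \<in> B i}"
proof -
  have "compactin (product_topology (\<lambda>i. euclidean) UNIV) (PiE UNIV B)"
    using assms by (simp add: compactin_PiE)
  moreover have "PiE UNIV B = {x. \<forall>i. x i \<in> B i}" by (auto simp: PiE_iff)
  ultimately show ?thesis by (simp add: euclidean_product_topology)
qed

lemma continuous_on_update:
  "continuous_on S (\<lambda>p :: (nat \<Rightarrow> complex) \<times> complex. (fst p)(j := snd p))"
proof (rule continuous_on_coordinatewise_then_product)
  fix i
  have "continuous_on S (\<lambda>p :: (nat \<Rightarrow> complex) \<times> complex. fst p i)"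
    by (rule continuous_on_product_then_coordinatewise) (intro continuous_intros)
  then show "continuous_on S (\<lambda>p :: (nat \<Rightarrow> complex) \<times> complex. ((fst p)(j := snd p)) i)"
    by (cases "i = j") (auto intro: continuous_intros)
qed

text \<open>Wallace's theorem on products of compact sets. It makes a single contour in coordinate
  \<open>j\<close> serve for all \<open>x\<close> near \<open>K\<close>.\<close>

lemma tube:
  assumes "compact K" "compact L" "open U"
    and "\<And>x \<zeta>. x \<in> K \<Longrightarrow> \<zeta> \<in> L \<Longrightarrow> x(j := \<zeta>) \<in> U"
  obtains N V where "open N" "open V" "K \<subseteq> N" "L \<subseteq> V"
    "\<And>x \<zeta>. x \<in> N \<Longrightarrow> \<zeta> \<in> V \<Longrightarrow> (x :: nat \<Rightarrow> complex)(j := \<zeta>) \<in> U"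
proof -
  define W where "W = (\<lambda>p :: (nat \<Rightarrow> complex) \<times> complex. (fst p)(j := snd p)) -` U"
  have "open W" unfolding W_def
    by (rule open_vimage[OF assms(3)]) (rule continuous_on_update)
  then have "openin (prod_topology euclidean euclidean) W" by simp
  moreover have "K \<times> L \<subseteq> W" using assms(4) by (auto simp: W_def)
  ultimately obtain N V where "open N" "open V" "K \<subseteq> N" "L \<subseteq> V" and NV: "N \<times> V \<subseteq> W"
    using Wallace_theorem_prod_topology[of euclidean K euclidean L W] assms(1,2) by auto
  moreover have "x(j := \<zeta>) \<in> U" if "x \<in> N" "\<zeta> \<in> V" for x \<zeta>
    using NV that by (auto simp: W_def)
  ultimately show thesis using that by blast
qed

lemma hol_update:
  assumes "hol f U" "\<And>x. x \<in> N \<Longrightarrow> x(j := \<zeta>) \<in> U"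
  shows "hol (\<lambda>x. f (x(j := \<zeta>))) N"
proof (rule hol_compose[OF assms(1)])
  show "hol (\<lambda>x. (x(j := \<zeta>)) i) N" for i by (cases "i = j") auto
qed (use assms in auto)

lemma holomorphic_update:
  assumes "hol f U" "open V" "\<And>\<zeta>. \<zeta> \<in> V \<Longrightarrow> x(j := \<zeta>) \<in> U"
  shows "(\<lambda>\<zeta>. f (x(j := \<zeta>))) holomorphic_on V"
proof (rule holD[OF assms(1,2)])
  show "(\<lambda>\<zeta>. (x(j := \<zeta>)) i) holomorphic_on V" for i by (cases "i = j") auto
qed (use assms in auto)

text \<open>The integral over one segment is holomorphic on both sides of it, so each side of a
  contour excludes only the points with \<open>x j\<close> on that very side.\<close>

lemma hol_cauchy_segment:
  assumes f: "hol f U" and NV: "\<And>x \<zeta>. x \<in> N \<Longrightarrow> \<zeta> \<in> V \<Longrightarrow> x(j := \<zeta>) \<in> U"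
    and pq: "closed_segment p q \<subseteq> V"
  shows "hol (\<lambda>x. contour_integral (linepath p q) (\<lambda>\<zeta>. f (x(j := \<zeta>)) / (\<zeta> - x j)))
     (N \<inter> {x. x j \<notin> closed_segment p q})" (is "hol _ ?N")
proof (rule hol_contour_integral)
  have "continuous_on (?N \<times> closed_segment p q) (\<lambda>p. f ((fst p)(j := snd p)))"
    using pq by (intro continuous_on_compose2[OF hol_continuous[OF f] continuous_on_update]) (auto intro!: NV)
  moreover have "continuous_on (?N \<times> closed_segment p q) (\<lambda>p. fst p j)"
    by (rule continuous_on_product_then_coordinatewise) (intro continuous_intros)
  ultimately show "continuous_on (?N \<times> path_image (linepath p q)) (\<lambda>(x, \<zeta>). f (x(j := \<zeta>)) / (\<zeta> - x j))"
    by (auto simp: case_prod_beta intro!: continuous_intros)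
next
  fix \<zeta> assume "\<zeta> \<in> path_image (linepath p q)"
  then show "hol (\<lambda>x. f (x(j := \<zeta>)) / (\<zeta> - x j)) ?N"
    using pq by (intro hol_divide hol_diff hol_update[OF f]) (auto intro!: NV)
qed auto

text \<open>Solvability of the additive Cousin problem for the two halves into which a real hyperplane
  cuts a polyhedron.\<close>
definition splits :: "((nat \<Rightarrow> complex) \<Rightarrow> complex) list \<Rightarrow> bool" where
  "splits Q \<longleftrightarrow> (\<forall>B j u c f U. (\<forall>i. compact (B i) \<and> convex (B i)) \<and> u \<noteq> 0 \<and> open U \<and> hol f U \<and>
      polyh (B(j := B j \<inter> {z. Re (u * z) = c})) Q \<subseteq> U \<longrightarrow>
     (\<exists>g1 g2 U1 U2 W. open U1 \<and> open U2 \<and> open W \<and> hol g1 U1 \<and> hol g2 U2 \<and>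
        polyh (B(j := B j \<inter> {z. Re (u * z) \<le> c})) Q \<subseteq> U1 \<and>
        polyh (B(j := B j \<inter> {z. Re (u * z) \<ge> c})) Q \<subseteq> U2 \<and>
        polyh (B(j := B j \<inter> {z. Re (u * z) = c})) Q \<subseteq> W \<and> W \<subseteq> U \<inter> U1 \<inter> U2 \<and>
        (\<forall>x\<in>W. f x = g1 x - g2 x)))"

lemma splitsE:
  assumes "splits Q" "\<And>i. compact (B i)" "\<And>i. convex (B i)" "u \<noteq> 0" "open U" "hol f U"
    "polyh (B(j := B j \<inter> {z. Re (u * z) = c})) Q \<subseteq> U"
  obtains g1 g2 U1 U2 W where "open U1" "open U2" "open W" "hol g1 U1" "hol g2 U2"
        "polyh (B(j := B j \<inter> {z. Re (u * z) \<le> c})) Q \<subseteq> U1"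
        "polyh (B(j := B j \<inter> {z. Re (u * z) \<ge> c})) Q \<subseteq> U2"
        "polyh (B(j := B j \<inter> {z. Re (u * z) = c})) Q \<subseteq> W" "W \<subseteq> U \<inter> U1 \<inter> U2"
        "\<And>x. x \<in> W \<Longrightarrow> f x = g1 x - g2 x"
proof -
  have "\<exists>g1 g2 U1 U2 W. open U1 \<and> open U2 \<and> open W \<and> hol g1 U1 \<and> hol g2 U2 \<and>
        polyh (B(j := B j \<inter> {z. Re (u * z) \<le> c})) Q \<subseteq> U1 \<and>
        polyh (B(j := B j \<inter> {z. Re (u * z) \<ge> c})) Q \<subseteq> U2 \<and>
        polyh (B(j := B j \<inter> {z. Re (u * z) = c})) Q \<subseteq> W \<and> W \<subseteq> U \<inter> U1 \<inter> U2 \<and>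
        (\<forall>x\<in>W. f x = g1 x - g2 x)"
    by (rule assms(1)[unfolded splits_def, THEN spec[of _ B], THEN spec[of _ j], THEN spec[of _ u],
          THEN spec[of _ c], THEN spec[of _ f], THEN spec[of _ U], THEN mp]) (use assms(2-) in simp)
  then show ?thesis by (elim exE conjE) (rule that, assumption+, blast)
qed

text \<open>The boundary is cut at \<open>p1\<close> and \<open>p4\<close>, where the vertical line
  through \<open>c\<close> leaves the rectangle at the bottom and at the top. The bracketed sums are
  the right half \<open>p1 p2 p3 p4\<close> and the left half \<open>p4 p5 p6 p1\<close> of the
  contour.\<close>

lemma cauchy_rectangle:
  fixes \<delta> a b c :: real
  defines "p1 \<equiv> Complex c (a - \<delta>)" and "p2 \<equiv> Complex (c + \<delta>) (a - \<delta>)" and "p3 \<equiv> Complex (c + \<delta>) (b + \<delta>)"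
    and "p4 \<equiv> Complex c (b + \<delta>)" and "p5 \<equiv> Complex (c - \<delta>) (b + \<delta>)" and "p6 \<equiv> Complex (c - \<delta>) (a - \<delta>)"
  assumes \<delta>: "\<delta> > 0" and ab: "a \<le> b" and S: "convex S" "open S" "cbox p6 p3 \<subseteq> S" and h: "h holomorphic_on S"
    and z: "z \<in> box p6 p3" and nz: "z \<notin> closed_segment p1 p2" "z \<notin> closed_segment p3 p4"
       "z \<notin> closed_segment p4 p5" "z \<notin> closed_segment p6 p1"
  defines "I \<equiv> \<lambda>p q. contour_integral (linepath p q) (\<lambda>\<zeta>. h \<zeta> / (\<zeta> - z))"
  shows "2 * pi * \<i> * h z = (I p1 p2 + I p2 p3 + I p3 p4) + (I p4 p5 + I p5 p6 + I p6 p1)"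
proof -
  let ?k = "\<lambda>\<zeta>. h \<zeta> / (\<zeta> - z)"
  have le: "Re p6 \<le> Re p3" "Im p6 \<le> Im p3" using \<delta> ab by (auto simp: p6_def p3_def)
  have zn: "z \<notin> path_image (rectpath p6 p3)"
    using z by (metis path_image_rectpath_cbox_minus_box[OF le] DiffD2)
  have ri: "path_image (rectpath p6 p3) \<subseteq> S - {z}"
    using path_image_rectpath_subset_cbox[OF le] S(3) zn by blast
  have zS: "z \<in> interior S" using z S box_subset_cbox interior_open by blast
  have main: "(?k has_contour_integral (2*pi * \<i> * 1 * h z)) (rectpath p6 p3)"
    using Cauchy_integral_formula_convex_simple[OF S(1) h zS valid_path_rectpath ri]
      winding_number_rectpath[OF z] by simp
  have ct: "continuous_on (S - {z}) ?k"
    using holomorphic_on_imp_continuous_on[OF h] by (auto intro!: continuous_intros intro: continuous_on_subset)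
  have in_seg: "p4 \<in> closed_segment p3 p5" "p1 \<in> closed_segment p6 p2"
    using \<delta> unfolding p1_def p2_def p3_def p4_def p5_def p6_def
    by (auto simp: closed_segment_def complex_eq_iff intro!: exI[of _ "1/2"] simp: field_simps)
  have rp: "rectpath p6 p3 = linepath p6 p2 +++ linepath p2 p3 +++ linepath p3 p5 +++ linepath p5 p6"
    by (simp add: rectpath_def Let_def p2_def p3_def p5_def p6_def)
  have pim: "path_image (rectpath p6 p3) = closed_segment p6 p2 \<union> closed_segment p2 p3 \<union> closed_segment p3 p5 \<union> closed_segment p5 p6"
    unfolding rp by (simp add: path_image_join Un_assoc)
  have ci: "continuous_on (closed_segment p6 p2) ?k" "continuous_on (closed_segment p2 p3) ?k"
     "continuous_on (closed_segment p3 p5) ?k" "continuous_on (closed_segment p5 p6) ?k"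
    using ri unfolding pim by (auto intro: continuous_on_subset[OF ct])
  have "contour_integral (rectpath p6 p3) ?k = I p6 p2 + I p2 p3 + I p3 p5 + I p5 p6"
    unfolding rp I_def using ci[THEN contour_integrable_continuous_linepath] by (simp add: add.assoc)
  moreover have "I p6 p2 = I p6 p1 + I p1 p2"
    unfolding I_def using ci(1) in_seg(2) by (rule contour_integral_split_linepath)
  moreover have "I p3 p5 = I p3 p4 + I p4 p5"
    unfolding I_def using ci(3) in_seg(1) by (rule contour_integral_split_linepath)
  ultimately show ?thesis using contour_integral_unique[OF main] by simp
qed

lemma compact_ball_subset_open:
  fixes K :: "'a::metric_space set"
  assumes "compact K" "open V" "K \<subseteq> V"
  obtains e where "e > 0" "\<And>x. x \<in> K \<Longrightarrow> ball x e \<subseteq> V"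
  using Heine_Borel_lemma[of K "{V}"] assms by auto

text \<open>Cauchy's formula on a rectangle around the slice of \<open>B j\<close> by the line Re z
  = c. The right half of the contour meets the half-plane Re z \<le> c only in its two end points,
  which lie below and above the slice and hence off \<open>B j\<close>. So its integral is
  holomorphic near the part of the box with Re \<le> c; the left half serves the other part.\<close>

lemma splits_Nil_vertical:
  assumes B: "\<And>i. compact (B i)" "\<And>i. convex (B i)" and U: "open U" "hol f U"
    and sub: "polyh (B(j := B j \<inter> {z. Re z = c})) [] \<subseteq> U"
  shows "\<exists>g1 g2 U1 U2 W. open U1 \<and> open U2 \<and> open W \<and> hol g1 U1 \<and> hol g2 U2 \<and>
        polyh (B(j := B j \<inter> {z. Re z \<le> c})) [] \<subseteq> U1 \<and>
        polyh (B(j := B j \<inter> {z. Re z \<ge> c})) [] \<subseteq> U2 \<and>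
        polyh (B(j := B j \<inter> {z. Re z = c})) [] \<subseteq> W \<and> W \<subseteq> U \<inter> U1 \<inter> U2 \<and>
        (\<forall>x\<in>W. f x = g1 x - g2 x)"
proof (cases "B j \<inter> {z. Re z = c} = {}")
  case True
  then have "polyh (B(j := B j \<inter> {z. Re z = c})) [] \<subseteq> {}" by (auto simp: polyh_def)
  then show ?thesis
    by (intro exI[of _ "\<lambda>_. 0"] exI[of _ UNIV] exI[of _ "{}"]) auto
next
  case False
  define Y where "Y = Im ` (B j \<inter> {z. Re z = c})"
  have "compact (B j \<inter> {z. Re z = c})"
    using B(1)[of j] by (intro compact_Int_closed closed_Collect_eq continuous_intros)
  then have Y: "compact Y" "Y \<noteq> {}" using False
    by (auto simp: Y_def intro!: compact_continuous_image continuous_intros)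
  obtain a where a: "a \<in> Y" "\<And>t. t \<in> Y \<Longrightarrow> a \<le> t" using compact_attains_inf[OF Y] by blast
  obtain b where b: "b \<in> Y" "\<And>t. t \<in> Y \<Longrightarrow> t \<le> b" using compact_attains_sup[OF Y] by blast
  have ab: "a \<le> b" using a b by blast
  have lineB: "a \<le> Im z \<and> Im z \<le> b" if "z \<in> B j" "Re z = c" for z
    using a(2) b(2) that by (auto simp: Y_def)
  define L where "L = cbox (Complex c a) (Complex c b)"
  have ends: "Complex c a \<in> B j" "Complex c b \<in> B j"
    using a(1) b(1) by (auto simp: Y_def complex_eq_iff) (metis complex_surj)+
  have LB: "L \<subseteq> B j"
  proof
    fix z assume z: "z \<in> L"
    then have "z \<in> closed_segment (Complex c a) (Complex c b)"
      by (auto simp: L_def in_cbox_complex_iff closed_segment_same_Re closed_segment_eq_real_ivl)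
    then show "z \<in> B j" using ends B(2) convex_contains_segment by blast
  qed
  \<comment> \<open>The old value of coordinate \<open>j\<close> is overwritten, so \<open>x\<close>
    may range over the whole box although \<open>f\<close> is given only near the slice. This is why
    the integrals below make sense on both halves.\<close>
  have "x(j := \<zeta>) \<in> U" if "x \<in> {x. \<forall>i. x i \<in> B i}" "\<zeta> \<in> L" for x \<zeta>
    using that LB by (intro subsetD[OF sub]) (auto simp: polyh_def L_def in_cbox_complex_iff)
  moreover have "compact {x. \<forall>i. x i \<in> B i}" by (rule compact_product[OF B(1)])
  moreover have "compact L" by (simp add: L_def)
  ultimately obtain N V where N: "open N" and V: "open V" and KN: "{x. \<forall>i. x i \<in> B i} \<subseteq> N" and LV: "L \<subseteq> V"
    and NV: "\<And>x \<zeta>. x \<in> N \<Longrightarrow> \<zeta> \<in> V \<Longrightarrow> x(j := \<zeta>) \<in> U"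
    using tube[of "{x. \<forall>i. x i \<in> B i}" L U j thesis] U(1) by blast
  obtain e where e: "e > 0" "\<And>x. x \<in> L \<Longrightarrow> ball x e \<subseteq> V"
    using compact_ball_subset_open[OF _ V LV] by (auto simp: L_def)
  \<comment> \<open>The open rectangle \<open>R\<close> is padded by \<open>2*\<delta>\<close>, so
    its points lie within \<open>4*\<delta> < e\<close> of \<open>L\<close>. The contour is padded
    by \<open>\<delta>\<close> only and thus lies inside the open convex set
    \<open>R\<close>.\<close>
  define \<delta> where "\<delta> = e / 5"
  have \<delta>: "\<delta> > 0" using e by (simp add: \<delta>_def)
  define p1 p2 p3 p4 p5 p6 where "p1 = Complex c (a - \<delta>)" and "p2 = Complex (c + \<delta>) (a - \<delta>)"
    and "p3 = Complex (c + \<delta>) (b + \<delta>)" and "p4 = Complex c (b + \<delta>)"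
    and "p5 = Complex (c - \<delta>) (b + \<delta>)" and "p6 = Complex (c - \<delta>) (a - \<delta>)"
  note pdefs = p1_def p2_def p3_def p4_def p5_def p6_def
  define R where "R = box (Complex (c - 2*\<delta>) (a - 2*\<delta>)) (Complex (c + 2*\<delta>) (b + 2*\<delta>))"
  have RV: "R \<subseteq> V"
  proof
    fix z assume z: "z \<in> R"
    define w where "w = Complex c (max a (min b (Im z)))"
    have "w \<in> L" using ab by (auto simp: w_def L_def in_cbox_complex_iff)
    moreover have "dist w z < e"
    proof -
      have "dist w z \<le> \<bar>Re (w - z)\<bar> + \<bar>Im (w - z)\<bar>" unfolding dist_norm by (rule cmod_le)
      also have "\<dots> < 2*\<delta> + 2*\<delta>"
        using z \<delta> by (intro add_strict_mono) (auto simp: w_def R_def in_box_complex_iff)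
      finally show ?thesis using e by (simp add: \<delta>_def)
    qed
    ultimately show "z \<in> V" using e(2)[of w] by (meson mem_ball subsetD)
  qed
  have boxR: "cbox p6 p3 \<subseteq> R" using \<delta> by (auto simp: R_def pdefs in_box_complex_iff in_cbox_complex_iff)
  have pts: "p1 \<in> cbox p6 p3" "p2 \<in> cbox p6 p3" "p3 \<in> cbox p6 p3" "p4 \<in> cbox p6 p3" "p5 \<in> cbox p6 p3" "p6 \<in> cbox p6 p3"
    using \<delta> ab by (auto simp: pdefs in_cbox_complex_iff)
  have segV: "closed_segment p q \<subseteq> V" if "p \<in> cbox p6 p3" "q \<in> cbox p6 p3" for p q
    using that boxR RV convex_box(1) by (meson closed_segment_subset order_trans)
  define I where "I = (\<lambda>p q x. contour_integral (linepath p q) (\<lambda>\<zeta>. f (x(j := \<zeta>)) / (\<zeta> - x j)))"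
  define s where "s = (\<lambda>p q. {x :: nat \<Rightarrow> complex. x j \<notin> closed_segment p q})"
  have hI: "hol (I p q) (N \<inter> s p q)" if "p \<in> cbox p6 p3" "q \<in> cbox p6 p3" for p q
    unfolding I_def s_def by (rule hol_cauchy_segment[OF U(2) NV segV[OF that]]) auto
  have os: "open (s p q)" for p q
  proof -
    have "s p q = (\<lambda>x. x j) -` (- closed_segment p q)" by (auto simp: s_def)
    then show ?thesis
      by (metis open_vimage[OF open_Compl[OF closed_segment] continuous_on_product_coordinates])
  qed
  define U1 where "U1 = N \<inter> (s p1 p2 \<inter> s p2 p3 \<inter> s p3 p4)"
  define U2 where "U2 = N \<inter> (s p4 p5 \<inter> s p5 p6 \<inter> s p6 p1)"
  define g1 where "g1 = (\<lambda>x. (I p1 p2 x + I p2 p3 x + I p3 p4 x) / (2 * pi * \<i>))"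
  define g2 where "g2 = (\<lambda>x. - (I p4 p5 x + I p5 p6 x + I p6 p1 x) / (2 * pi * \<i>))"
  \<comment> \<open>Cauchy's formula represents \<open>f\<close> only for \<open>x j\<close> inside
    the contour, which confines the identity to this set.\<close>
  define W where "W = U \<inter> U1 \<inter> U2 \<inter> {x. x j \<in> box p6 p3}"
  have oU: "open U1" "open U2" unfolding U1_def U2_def by (intro open_Int N os)+
  have "open ((\<lambda>x. x j) -` box p6 p3)"
    by (rule open_vimage[OF open_box continuous_on_product_coordinates])
  then have oW: "open W" unfolding W_def vimage_def using oU U(1) by auto
  have h1: "hol g1 U1" unfolding g1_def U1_def
    by (intro hol_divide hol_add hol_const hol_subset[OF hI]) (use pts in auto)
  have h2: "hol g2 U2" unfolding g2_def U2_def
    by (intro hol_divide hol_uminus hol_add hol_const hol_subset[OF hI]) (use pts in auto)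
  have cs: "closed_segment p1 p2 \<subseteq> {z. Im z = a - \<delta> \<and> Re z \<ge> c}" "closed_segment p2 p3 \<subseteq> {z. Re z = c + \<delta>}"
     "closed_segment p3 p4 \<subseteq> {z. Im z = b + \<delta> \<and> Re z \<ge> c}" "closed_segment p4 p5 \<subseteq> {z. Im z = b + \<delta> \<and> Re z \<le> c}"
     "closed_segment p5 p6 \<subseteq> {z. Re z = c - \<delta>}" "closed_segment p6 p1 \<subseteq> {z. Im z = a - \<delta> \<and> Re z \<le> c}"
    using \<delta> ab by (auto simp: pdefs closed_segment_same_Re closed_segment_same_Im closed_segment_eq_real_ivl split: if_splits)
  have lo: "polyh (B(j := B j \<inter> {z. Re z \<le> c})) [] \<subseteq> U1"
  proof
    fix x assume "x \<in> polyh (B(j := B j \<inter> {z. Re z \<le> c})) []"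
    then have *: "x j \<in> B j" "Re (x j) \<le> c" "\<forall>i. x i \<in> B i" by (auto simp: polyh_def split: if_splits)
    have "x j \<notin> closed_segment p1 p2" "x j \<notin> closed_segment p2 p3" "x j \<notin> closed_segment p3 p4"
    proof -
      have "\<not> (Im (x j) = a - \<delta> \<and> Re (x j) \<ge> c)" "\<not> (Im (x j) = b + \<delta> \<and> Re (x j) \<ge> c)" "Re (x j) \<noteq> c + \<delta>"
        using * lineB[of "x j"] \<delta> by linarith+
      then show "x j \<notin> closed_segment p1 p2" "x j \<notin> closed_segment p2 p3" "x j \<notin> closed_segment p3 p4"
        using cs by blast+
    qed
    then show "x \<in> U1" using KN * by (auto simp: U1_def s_def)
  qed
  have hi: "polyh (B(j := B j \<inter> {z. Re z \<ge> c})) [] \<subseteq> U2"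
  proof
    fix x assume "x \<in> polyh (B(j := B j \<inter> {z. Re z \<ge> c})) []"
    then have *: "x j \<in> B j" "Re (x j) \<ge> c" "\<forall>i. x i \<in> B i" by (auto simp: polyh_def split: if_splits)
    have "x j \<notin> closed_segment p4 p5" "x j \<notin> closed_segment p5 p6" "x j \<notin> closed_segment p6 p1"
    proof -
      have "\<not> (Im (x j) = a - \<delta> \<and> Re (x j) \<le> c)" "\<not> (Im (x j) = b + \<delta> \<and> Re (x j) \<le> c)" "Re (x j) \<noteq> c - \<delta>"
        using * lineB[of "x j"] \<delta> by linarith+
      then show "x j \<notin> closed_segment p4 p5" "x j \<notin> closed_segment p5 p6" "x j \<notin> closed_segment p6 p1"
        using cs by blast+
    qed
    then show "x \<in> U2" using KN * by (auto simp: U2_def s_def)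
  qed
  have mid: "polyh (B(j := B j \<inter> {z. Re z = c})) [] \<subseteq> W"
  proof
    fix x assume x: "x \<in> polyh (B(j := B j \<inter> {z. Re z = c})) []"
    then have *: "x j \<in> B j" "Re (x j) = c" by (auto simp: polyh_def split: if_splits)
    have "x j \<in> box p6 p3" using lineB[OF *] * \<delta> by (auto simp: pdefs in_box_complex_iff)
    moreover have "x \<in> U" using x sub by blast
    moreover have "x \<in> U1" using x by (intro subsetD[OF lo]) (auto simp: polyh_def split: if_splits)
    moreover have "x \<in> U2" using x by (intro subsetD[OF hi]) (auto simp: polyh_def split: if_splits)
    ultimately show "x \<in> W" by (simp add: W_def)
  qed
  have eq: "f x = g1 x - g2 x" if x: "x \<in> W" for x
  proof -
    have xN: "x \<in> N" using x by (auto simp: W_def U1_def)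
    have h: "(\<lambda>\<zeta>. f (x(j := \<zeta>))) holomorphic_on R"
      by (rule holomorphic_update[OF U(2)]) (use NV[OF xN] RV in \<open>auto simp: R_def open_box\<close>)
    have "2 * pi * \<i> * f (x(j := x j)) = (I p1 p2 x + I p2 p3 x + I p3 p4 x) + (I p4 p5 x + I p5 p6 x + I p6 p1 x)"
      unfolding I_def pdefs
      by (rule cauchy_rectangle[OF \<delta> ab _ _ _ h, unfolded R_def])
        (use x boxR in \<open>auto simp: W_def U1_def U2_def s_def pdefs open_box R_def\<close>)
    moreover have "g1 x - g2 x =
        ((I p1 p2 x + I p2 p3 x + I p3 p4 x) + (I p4 p5 x + I p5 p6 x + I p6 p1 x)) / (2 * pi * \<i>)"
      unfolding g1_def g2_def by (simp add: add_divide_distrib diff_divide_distrib)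
    moreover have "f x = (2 * pi * \<i> * f (x(j := x j))) / (2 * pi * \<i>)" by simp
    ultimately show ?thesis by metis
  qed
  show ?thesis
    by (rule exI[of _ g1], rule exI[of _ g2], rule exI[of _ U1], rule exI[of _ U2], rule exI[of _ W])
      (use oU oW h1 h2 lo hi mid eq in \<open>auto simp: W_def\<close>)
qed

text \<open>Multiplying coordinate \<open>j\<close> by \<open>u\<close> makes the hyperplane
  vertical; \<open>\<sigma>\<close> is this change of variable and \<open>\<rho>\<close> its
  inverse.\<close>

lemma splits_Nil: "splits []"
  unfolding splits_def
proof (intro allI impI, elim conjE)
  fix B :: "nat \<Rightarrow> complex set" and j u c f U
  assume "\<forall>i. compact (B i) \<and> convex (B i)" and u: "u \<noteq> 0" and U: "open U" "hol f U"
    and sub: "polyh (B(j := B j \<inter> {z. Re (u * z) = c})) [] \<subseteq> U"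
  then have B: "compact (B i)" "convex (B i)" for i by auto
  define \<rho> where "\<rho> = (\<lambda>x :: nat \<Rightarrow> complex. x(j := x j / u))"
  define \<sigma> where "\<sigma> = (\<lambda>x :: nat \<Rightarrow> complex. x(j := u * x j))"
  define A where "A = B(j := (*) u ` B j)"
  have A: "compact (A i)" "convex (A i)" for i
    using B by (auto simp: A_def intro!: compact_continuous_image continuous_intros convex_linear_image
        bounded_linear.linear[OF bounded_linear_mult_right])
  have h\<rho>: "hol (\<lambda>x. \<rho> x i) X" for i X
    by (cases "i = j") (auto simp: \<rho>_def u intro!: hol_divide)
  have h\<sigma>: "hol (\<lambda>x. \<sigma> x i) X" for i X
    by (cases "i = j") (auto simp: \<sigma>_def intro!: hol_mult)
  have \<rho>\<sigma> [simp]: "\<rho> (\<sigma> x) = x" for x using u by (auto simp: \<rho>_def \<sigma>_def)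
  have c\<rho>: "continuous_on UNIV \<rho>" and c\<sigma>: "continuous_on UNIV \<sigma>"
    using h\<rho> h\<sigma> by (auto intro!: continuous_on_coordinatewise_then_product hol_continuous)
  have \<sigma>P: "\<sigma> x \<in> polyh (A(j := A j \<inter> {z. P (Re z)})) [] " if "x \<in> polyh (B(j := B j \<inter> {z. P (Re (u * z))})) []" for x P
    using that by (auto simp: polyh_def \<sigma>_def A_def split: if_splits)
  have \<rho>P: "\<rho> x \<in> polyh (B(j := B j \<inter> {z. Re (u * z) = c})) []" if "x \<in> polyh (A(j := A j \<inter> {z. Re z = c})) []" for x
  proof -
    have *: "x j \<in> (*) u ` B j" "Re (x j) = c" "\<And>i. i \<noteq> j \<Longrightarrow> x i \<in> B i"
      using that by (force simp: polyh_def A_def split: if_splits)+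
    then have "x j / u \<in> B j" "u * (x j / u) = x j" using u by auto
    then show ?thesis using * by (auto simp: polyh_def \<rho>_def simp del: times_complex.sel)
  qed
  have "\<exists>g1 g2 U1 U2 W. open U1 \<and> open U2 \<and> open W \<and> hol g1 U1 \<and> hol g2 U2 \<and>
        polyh (A(j := A j \<inter> {z. Re z \<le> c})) [] \<subseteq> U1 \<and>
        polyh (A(j := A j \<inter> {z. Re z \<ge> c})) [] \<subseteq> U2 \<and>
        polyh (A(j := A j \<inter> {z. Re z = c})) [] \<subseteq> W \<and> W \<subseteq> \<rho> -` U \<inter> U1 \<inter> U2 \<and>
        (\<forall>x\<in>W. f (\<rho> x) = g1 x - g2 x)"
  proof (rule splits_Nil_vertical[OF A])
    show "open (\<rho> -` U)" by (rule open_vimage[OF U(1) c\<rho>])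
    show "hol (\<lambda>x. f (\<rho> x)) (\<rho> -` U)" by (rule hol_compose[OF U(2) h\<rho>]) auto
    show "polyh (A(j := A j \<inter> {z. Re z = c})) [] \<subseteq> \<rho> -` U" using \<rho>P sub by blast
  qed
  then obtain g1 g2 U1 U2 W where *: "open U1" "open U2" "open W" "hol g1 U1" "hol g2 U2"
        "polyh (A(j := A j \<inter> {z. Re z \<le> c})) [] \<subseteq> U1"
        "polyh (A(j := A j \<inter> {z. Re z \<ge> c})) [] \<subseteq> U2"
        "polyh (A(j := A j \<inter> {z. Re z = c})) [] \<subseteq> W" "W \<subseteq> \<rho> -` U \<inter> U1 \<inter> U2"
        "\<forall>x\<in>W. f (\<rho> x) = g1 x - g2 x" by (elim exE conjE) (rule that)
  show "\<exists>g1 g2 U1 U2 W. open U1 \<and> open U2 \<and> open W \<and> hol g1 U1 \<and> hol g2 U2 \<and>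
        polyh (B(j := B j \<inter> {z. Re (u * z) \<le> c})) [] \<subseteq> U1 \<and>
        polyh (B(j := B j \<inter> {z. Re (u * z) \<ge> c})) [] \<subseteq> U2 \<and>
        polyh (B(j := B j \<inter> {z. Re (u * z) = c})) [] \<subseteq> W \<and> W \<subseteq> U \<inter> U1 \<inter> U2 \<and>
        (\<forall>x\<in>W. f x = g1 x - g2 x)"
  proof (intro exI conjI ballI)
    show "open (\<sigma> -` U1)" "open (\<sigma> -` U2)" "open (\<sigma> -` W)" using * c\<sigma> by (auto intro: open_vimage)
    show "hol (\<lambda>x. g1 (\<sigma> x)) (\<sigma> -` U1)" "hol (\<lambda>x. g2 (\<sigma> x)) (\<sigma> -` U2)"
      by (auto intro!: hol_compose[OF *(4)] hol_compose[OF *(5)] h\<sigma>)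
    show "polyh (B(j := B j \<inter> {z. Re (u * z) \<le> c})) [] \<subseteq> \<sigma> -` U1"
      using \<sigma>P[of _ "\<lambda>t. t \<le> c"] *(6) by blast
    show "polyh (B(j := B j \<inter> {z. Re (u * z) \<ge> c})) [] \<subseteq> \<sigma> -` U2"
      using \<sigma>P[of _ "\<lambda>t. t \<ge> c"] *(7) by blast
    show "polyh (B(j := B j \<inter> {z. Re (u * z) = c})) [] \<subseteq> \<sigma> -` W"
      using \<sigma>P[of _ "\<lambda>t. t = c"] *(8) by blast
    show "\<sigma> -` W \<subseteq> U \<inter> \<sigma> -` U1 \<inter> \<sigma> -` U2"     proof
      fix x assume "x \<in> \<sigma> -` W"
      then have "\<sigma> x \<in> \<rho> -` U \<inter> U1 \<inter> U2" using *(9) by blast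
      then show "x \<in> U \<inter> \<sigma> -` U1 \<inter> \<sigma> -` U2" by simp
    qed
    show "f x = g1 (\<sigma> x) - g2 (\<sigma> x)" if "x \<in> \<sigma> -` W" for x using *(10)[rule_format, of "\<sigma> x"] that by simp
  qed
qed

section \<open>Extension from a zero set\<close>

text \<open>Only finitely many coordinates have to be cut, because the others hardly contribute to the
  metric of the product.\<close>

lemma box_induction:
  fixes B :: "nat \<Rightarrow> complex set"
  assumes B: "\<And>i. compact (B i)" "\<And>i. convex (B i)"
    and empty: "\<And>C. {x. \<forall>i. x i \<in> C i} = {} \<Longrightarrow> P C"
    and local: "\<And>y. (\<And>i. y i \<in> B i) \<Longrightarrow>
        \<exists>G. open G \<and> y \<in> G \<and> (\<forall>C. {x. \<forall>i. x i \<in> C i} \<subseteq> G \<longrightarrow> P C)"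
    and merge: "\<And>C j u c. (\<And>i. compact (C i)) \<Longrightarrow> (\<And>i. convex (C i)) \<Longrightarrow> (\<And>i. C i \<subseteq> B i) \<Longrightarrow> u \<noteq> 0 \<Longrightarrow>
        P (C(j := C j \<inter> {z. Re (u * z) \<le> c})) \<Longrightarrow> P (C(j := C j \<inter> {z. Re (u * z) \<ge> c})) \<Longrightarrow> P C"
  shows "P B"
proof -
  define K where "K = {x. \<forall>i. x i \<in> B i}"
  define GG where "GG = {G. open G \<and> (\<forall>C. {x. \<forall>i. x i \<in> C i} \<subseteq> G \<longrightarrow> P C)}"
  have "compact K" unfolding K_def by (rule compact_product[OF B(1)])
  moreover have "K \<subseteq> \<Union>GG"
  proof
    fix y assume "y \<in> K"
    then have "y i \<in> B i" for i by (simp add: K_def)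
    from local[OF this] show "y \<in> \<Union>GG" unfolding GG_def by blast
  qed
  ultimately obtain e where e: "e > 0" "\<And>x. x \<in> K \<Longrightarrow> \<exists>G\<in>GG. ball x e \<subseteq> G"
    by (rule Heine_Borel_lemma) (auto simp: GG_def)
  obtain N where N: "(1/2::real) ^ N < e / 2"
    using e real_arch_pow_inv[of "e/2" "1/2"] by auto
  define F where "F = (from_nat :: nat \<Rightarrow> nat) ` {..N}"
  \<comment> \<open>Real and imaginary parts within \<open>e / 16\<close> put each coordinate within
    \<open>e / 8\<close>. The product distance is at most twice the largest of the first distances
    plus the tail \<open>(1/2) ^ N\<close>, hence below \<open>e / 4 + e / 2\<close>.\<close>
  define \<delta> where "\<delta> = e / 16"
  have \<delta>: "\<delta> > 0" using e by (simp add: \<delta>_def)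
  \<comment> \<open>The factor 1 cuts by real parts and - \<i> by imaginary parts, as Re (- \<i> *
    z) = Im z.\<close>
  define J where "J = F \<times> {1, - \<i>}"
  have "finite J" by (simp add: J_def F_def)
  have small: "P C" if C: "\<And>i. C i \<subseteq> B i"
    and w: "\<And>j u z w. (j, u) \<in> J \<Longrightarrow> z \<in> C j \<Longrightarrow> w \<in> C j \<Longrightarrow> \<bar>Re (u * z) - Re (u * w)\<bar> < \<delta>" for C
  proof (cases "{x. \<forall>i. x i \<in> C i} = {}")
    case True then show ?thesis by (rule empty)
  next
    case False
    then obtain x where x: "\<And>i. x i \<in> C i" by auto
    have "x \<in> K" using x C by (auto simp: K_def)
    then obtain G where G: "G \<in> GG" "ball x e \<subseteq> G" using e(2) by blast
    have "y \<in> ball x e" if y: "\<And>i. y i \<in> C i" for y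
    proof -
      have d: "dist (x (from_nat n)) (y (from_nat n)) < e / 8" if "n \<le> N" for n
      proof -
        let ?i = "from_nat n :: nat"
        have "(?i, 1) \<in> J" "(?i, - \<i>) \<in> J" using that by (auto simp: J_def F_def)
        then have "\<bar>Re (x ?i) - Re (y ?i)\<bar> < \<delta>" "\<bar>Im (x ?i) - Im (y ?i)\<bar> < \<delta>"
          using w[OF _ x y, of ?i 1] w[OF _ x y, of ?i "- \<i>"] by auto
        moreover have "dist (x ?i) (y ?i) \<le> \<bar>Re (x ?i - y ?i)\<bar> + \<bar>Im (x ?i - y ?i)\<bar>"
          unfolding dist_norm by (rule cmod_le)
        ultimately show ?thesis by (simp add: \<delta>_def)
      qed
      have "{dist (x (from_nat n)) (y (from_nat n)) |n. n \<le> N} = (\<lambda>n. dist (x (from_nat n)) (y (from_nat n))) ` {..N}"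
        by auto
      then have "Max {dist (x (from_nat n)) (y (from_nat n)) |n. n \<le> N} < e / 8"
        using d by (subst Max_less_iff) auto
      then have "dist x y < e"
        using dist_fun_le_dist_first_terms[of x y N] N e(1) by linarith
      then show ?thesis by simp
    qed
    then show ?thesis using G unfolding GG_def by blast
  qed
  \<comment> \<open>\<open>I\<close> holds the directions in which \<open>C\<close> may still be
    wide; when none is left, \<open>small\<close> applies.\<close>
  have gen: "P C" if "finite I" "\<And>i. compact (C i)" "\<And>i. convex (C i)" "\<And>i. C i \<subseteq> B i"
    and "\<And>j u z w. (j, u) \<in> J - I \<Longrightarrow> z \<in> C j \<Longrightarrow> w \<in> C j \<Longrightarrow> \<bar>Re (u * z) - Re (u * w)\<bar> < \<delta>"
    and "\<And>j u. (j, u) \<in> I \<Longrightarrow> u \<noteq> 0" for C and I :: "(nat \<times> complex) set"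
    using that
  proof (induction I arbitrary: C rule: finite_induct)
    case empty
    then show ?case by (intro small) auto
  next
    case (insert ju I)
    obtain j u where ju: "ju = (j, u)" by force
    have u: "u \<noteq> 0" using insert.prems(5) ju by auto
    define D where "D \<alpha> \<beta> = C(j := C j \<inter> {z. \<alpha> \<le> Re (u * z) \<and> Re (u * z) \<le> \<beta>})" for \<alpha> \<beta>
    have slab: "compact (C j \<inter> {z. \<alpha> \<le> Re (u * z) \<and> Re (u * z) \<le> \<beta>})"
       "convex (C j \<inter> {z. \<alpha> \<le> Re (u * z) \<and> Re (u * z) \<le> \<beta>})" for \<alpha> \<beta>
    proof -
      have eq: "{z. \<alpha> \<le> Re (u * z) \<and> Re (u * z) \<le> \<beta>} = (\<lambda>z. Re (u * z)) -` {\<alpha>..\<beta>}" by auto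
      have "closed ((\<lambda>z. Re (u * z)) -` {\<alpha>..\<beta>})"
        by (intro closed_vimage continuous_intros closed_atLeastAtMost)
      then show "compact (C j \<inter> {z. \<alpha> \<le> Re (u * z) \<and> Re (u * z) \<le> \<beta>})"
        unfolding eq by (intro compact_Int_closed insert.prems(1))
      have "linear (\<lambda>z. Re (u * z))"
        by (intro bounded_linear.linear bounded_linear_compose[OF bounded_linear_Re] bounded_linear_mult_right)
      then show "convex (C j \<inter> {z. \<alpha> \<le> Re (u * z) \<and> Re (u * z) \<le> \<beta>})"
        unfolding eq by (intro convex_Int insert.prems(2) convex_linear_vimage convex_real_interval)
    qed
    have D: "compact (D \<alpha> \<beta> i)" "convex (D \<alpha> \<beta> i)" "D \<alpha> \<beta> i \<subseteq> C i" "D \<alpha> \<beta> i \<subseteq> B i" for \<alpha> \<beta> i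
      by (cases "i = j"; use slab insert.prems(1-3)[of i] in \<open>auto simp: D_def simp del: times_complex.sel\<close>)+
    have "bounded ((\<lambda>z. u * z) ` C j)"
      by (intro compact_imp_bounded compact_continuous_image continuous_intros insert.prems(1))
    then obtain R where R: "\<And>z. z \<in> C j \<Longrightarrow> norm (u * z) \<le> R"
      by (auto simp: bounded_iff)
    have "- \<bar>R\<bar> \<le> Re (u * z)" "Re (u * z) \<le> \<bar>R\<bar>" if "z \<in> C j" for z
      using abs_Re_le_cmod[of "u * z"] R[OF that] by linarith+
    then have "C j \<inter> {z. - \<bar>R\<bar> \<le> Re (u * z) \<and> Re (u * z) \<le> \<bar>R\<bar>} = C j" by blast
    \<comment> \<open>This slab cuts nothing off. The absolute value keeps the interval nonempty
      even if \<open>C j\<close> is empty and \<open>R\<close> negative.\<close>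
    then have DR: "D (- \<bar>R\<bar>) \<bar>R\<bar> = C" by (simp only: D_def fun_upd_triv)
    \<comment> \<open>Bisection in the values of Re (u * z): \<open>merge\<close> joins adjacent
      slabs, and a slab thinner than \<open>\<delta>\<close> is no longer wide in direction
      \<open>(j, u)\<close>, so the induction hypothesis covers it.\<close>
    have "- \<bar>R\<bar> \<le> \<bar>R\<bar>" by simp
    then have "P (D (- \<bar>R\<bar>) \<bar>R\<bar>)"
    proof (induction rule: Bolzano)
      case (trans \<alpha> \<beta> \<gamma>)
      have "(D \<alpha> \<gamma>)(j := D \<alpha> \<gamma> j \<inter> {z. Re (u * z) \<le> \<beta>}) = D \<alpha> \<beta>"
        "(D \<alpha> \<gamma>)(j := D \<alpha> \<gamma> j \<inter> {z. Re (u * z) \<ge> \<beta>}) = D \<beta> \<gamma>"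
        using trans(3,4) by (auto simp: D_def fun_eq_iff simp del: times_complex.sel)
      then show ?case using trans(1,2) merge[of "D \<alpha> \<gamma>" u j \<beta>, OF D(1,2,4) u] by simp
    next
      case (local x)
      show ?case
      proof (intro exI[of _ \<delta>] conjI \<delta> allI impI)
        fix \<alpha> \<beta> assume *: "\<alpha> \<le> x \<and> x \<le> \<beta> \<and> \<beta> - \<alpha> < \<delta>"
        show "P (D \<alpha> \<beta>)"
        proof (rule insert.IH[OF D(1,2,4)])
          fix k v z w assume kv: "(k, v) \<in> J - I" and zw: "z \<in> D \<alpha> \<beta> k" "w \<in> D \<alpha> \<beta> k"
          show "\<bar>Re (v * z) - Re (v * w)\<bar> < \<delta>"
          proof (cases "(k, v) = (j, u)")
            case True
            then have "\<alpha> \<le> Re (v * z)" "Re (v * z) \<le> \<beta>" "\<alpha> \<le> Re (v * w)" "Re (v * w) \<le> \<beta>"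
              using zw by (auto simp: D_def simp del: times_complex.sel)
            then show ?thesis using * by linarith
          next
            case False
            then show ?thesis using kv zw D(3) ju by (intro insert.prems(4)[of k v]) auto
          qed
        next
          show "\<And>k v. (k, v) \<in> I \<Longrightarrow> v \<noteq> 0" using insert.prems(5) by auto
        qed
      qed
    qed
    then show ?case unfolding DR .
  qed
  show ?thesis by (rule gen[of J B]) (use \<open>finite J\<close> B in \<open>auto simp: J_def\<close>)
qed

lemma open_halfspace_coord:
  "open {x :: nat \<Rightarrow> complex. Re (u * x j) < c}" "open {x :: nat \<Rightarrow> complex. Re (u * x j) > c}"
proof -
  have "continuous_on UNIV (\<lambda>x :: nat \<Rightarrow> complex. Re (u * x j))"
    by (intro continuous_on_Re continuous_on_mult continuous_on_const continuous_on_product_coordinates)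
  then show "open {x :: nat \<Rightarrow> complex. Re (u * x j) < c}" "open {x :: nat \<Rightarrow> complex. Re (u * x j) > c}"
    by (simp_all add: open_Collect_less)
qed

text \<open>On \<open>W\<close>, the piece meant to cover the hyperplane, \<open>A\<close> and
  \<open>B\<close> coincide and the case distinction is invisible; elsewhere only one branch is
  active.\<close>

lemma hol_glue:
  assumes o: "open UA" "open UB" "open W" and h: "hol A UA" "hol B UB" and W: "W \<subseteq> UA \<inter> UB"
    and eq: "\<And>x. x \<in> W \<Longrightarrow> A x = B x"
  shows "hol (\<lambda>x. if Re (u * x j) \<le> c then A x else B x)
     ((UA \<inter> {x. Re (u * x j) < c}) \<union> W \<union> (UB \<inter> {x. Re (u * x j) > c}))"
    (is "hol ?G (?X \<union> W \<union> ?Y)")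
proof (rule hol_local)
  have oXY: "open ?X" "open ?Y" by (intro open_Int o open_halfspace_coord)+
  have hX: "hol ?G ?X" by (rule hol_cong[OF hol_subset[OF h(1)]]) auto
  have hY: "hol ?G ?Y" by (rule hol_cong[OF hol_subset[OF h(2)]]) auto
  have hW: "hol ?G W" by (rule hol_cong[OF hol_subset[OF h(1)]]) (use W eq in auto)
  fix x assume "x \<in> ?X \<union> W \<union> ?Y"
  then show "\<exists>V. open V \<and> x \<in> V \<and> hol ?G V" using oXY o(3) hX hY hW by blast
qed

text \<open>The function F extends f across the polyhedron up to a multiple of r; carrying the quotient h
  along makes the differences of two such extensions divisible by r without a division theorem.\<close>
definition extends :: "((nat \<Rightarrow> complex) \<Rightarrow> complex) list \<Rightarrow> ((nat \<Rightarrow> complex) \<Rightarrow> complex) \<Rightarrow>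
    ((nat \<Rightarrow> complex) \<Rightarrow> complex) \<Rightarrow> (nat \<Rightarrow> complex) set \<Rightarrow> (nat \<Rightarrow> complex set) \<Rightarrow> bool" where
  "extends Q r f U B \<longleftrightarrow> (\<exists>F h V. open V \<and> polyh B Q \<subseteq> V \<and> hol F V \<and> hol h (V \<inter> U) \<and>
      (\<forall>y\<in>V \<inter> U. F y - f y = r y * h y))"

text \<open>If F1 - F2 = r * k near the slice and k = g1 - g2, then F1 - r * g1 = F2 - r * g2 there.
  Both corrections are multiples of \<open>r\<close>, so the glued function still extends
  \<open>f\<close>, with quotients h1 - g1 and h2 - g2.\<close>

lemma extends_merge:
  assumes Q: "splits Q" and B: "\<And>i. compact (B i)" "\<And>i. convex (B i)" and u: "u \<noteq> 0"
    and U: "open U" "hol f U" and r: "hol r UNIV"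
    and zero: "\<And>y. y \<in> polyh B Q \<Longrightarrow> r y = 0 \<Longrightarrow> y \<in> U"
    and lo: "extends Q r f U (B(j := B j \<inter> {z. Re (u * z) \<le> c}))"
    and hi: "extends Q r f U (B(j := B j \<inter> {z. Re (u * z) \<ge> c}))"
  shows "extends Q r f U B"
proof -
  obtain F1 h1 V1 where 1: "open V1" "polyh (B(j := B j \<inter> {z. Re (u * z) \<le> c})) Q \<subseteq> V1" "hol F1 V1"
      "hol h1 (V1 \<inter> U)" "\<And>y. y \<in> V1 \<inter> U \<Longrightarrow> F1 y - f y = r y * h1 y"
    using lo unfolding extends_def by blast
  obtain F2 h2 V2 where 2: "open V2" "polyh (B(j := B j \<inter> {z. Re (u * z) \<ge> c})) Q \<subseteq> V2" "hol F2 V2"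
      "hol h2 (V2 \<inter> U)" "\<And>y. y \<in> V2 \<inter> U \<Longrightarrow> F2 y - f y = r y * h2 y"
    using hi unfolding extends_def by blast
  let ?mid = "polyh (B(j := B j \<inter> {z. Re (u * z) = c})) Q"
  \<comment> \<open>Where \<open>r\<close> vanishes the quotient is undefined and h1 - h2 takes its
    place; inside \<open>U\<close> the two formulas agree wherever both make sense, so no
    singularity arises.\<close>
  define k where "k = (\<lambda>y. if r y \<noteq> 0 then (F1 y - F2 y) / r y else h1 y - h2 y)"
  have "open (r -` (- {0}))" by (rule open_vimage) (auto intro: hol_continuous[OF r])
  then have onz: "open {y. r y \<noteq> 0}" by (simp add: vimage_def)
  \<comment> \<open>The slice lies in this set exactly because \<open>zero\<close> puts every zero
    of \<open>r\<close> on the polyhedron into \<open>U\<close>.\<close>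
  define W0 where "W0 = V1 \<inter> V2 \<inter> (U \<union> {y. r y \<noteq> 0})"
  have oW0: "open W0" unfolding W0_def using 1(1) 2(1) U(1) onz by auto
  have kU: "k y = h1 y - h2 y" if "y \<in> V1 \<inter> V2 \<inter> U" for y
  proof -
    have "F1 y - F2 y = r y * (h1 y - h2 y)" using 1(5)[of y] 2(5)[of y] that by (simp add: algebra_simps)
    then show ?thesis by (simp add: k_def)
  qed
  have kF: "F1 y - F2 y = r y * k y" if "y \<in> W0" for y
  proof (cases "r y = 0")
    case True
    then have "y \<in> V1 \<inter> U" "y \<in> V2 \<inter> U" using that by (auto simp: W0_def)
    then show ?thesis using 1(5)[of y] 2(5)[of y] True by simp
  qed (simp add: k_def)
  have hk: "hol k W0"
  proof (rule hol_local)
    fix y assume y: "y \<in> W0"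
    show "\<exists>V. open V \<and> y \<in> V \<and> hol k V"
    proof (cases "r y = 0")
      case True
      have "hol (\<lambda>y. h1 y - h2 y) (V1 \<inter> V2 \<inter> U)"
        by (intro hol_diff hol_subset[OF 1(4)] hol_subset[OF 2(4)]) auto
      then have "hol k (V1 \<inter> V2 \<inter> U)" by (rule hol_cong) (simp add: kU)
      moreover have "open (V1 \<inter> V2 \<inter> U)" using 1 2 U by auto
      ultimately show ?thesis using y True by (auto simp: W0_def)
    next
      case False
      let ?V = "V1 \<inter> V2 \<inter> {y. r y \<noteq> 0}"
      have "hol (\<lambda>y. (F1 y - F2 y) / r y) ?V"
        by (intro hol_divide hol_diff hol_subset[OF 1(3)] hol_subset[OF 2(3)] hol_subset[OF r]) auto
      then have "hol k ?V" by (rule hol_cong) (simp add: k_def)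
      moreover have "open ?V" using 1 2 onz by auto
      ultimately show ?thesis using y False by (auto simp: W0_def)
    qed
  qed
  have midW0: "?mid \<subseteq> W0"
  proof
    fix y assume y: "y \<in> ?mid"
    then have "y \<in> polyh (B(j := B j \<inter> {z. Re (u * z) \<le> c})) Q" "y \<in> polyh (B(j := B j \<inter> {z. Re (u * z) \<ge> c})) Q"
      "y \<in> polyh B Q"
      unfolding polyh_def by (auto split: if_splits simp del: times_complex.sel)
    then show "y \<in> W0" using 1(2) 2(2) zero[of y] by (auto simp: W0_def)
  qed
  obtain g1 g2 U1 U2 W where g: "open U1" "open U2" "open W" "hol g1 U1" "hol g2 U2"
        "polyh (B(j := B j \<inter> {z. Re (u * z) \<le> c})) Q \<subseteq> U1"
        "polyh (B(j := B j \<inter> {z. Re (u * z) \<ge> c})) Q \<subseteq> U2"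
        "?mid \<subseteq> W" "W \<subseteq> W0 \<inter> U1 \<inter> U2"
        "\<And>x. x \<in> W \<Longrightarrow> k x = g1 x - g2 x"
    by (rule splitsE[of Q B u W0 k j c, OF Q B u oW0 hk midW0]) (rule that; assumption)
  define UA UB where "UA = V1 \<inter> U1" and "UB = V2 \<inter> U2"
  have oAB: "open UA" "open UB" using 1 2 g by (auto simp: UA_def UB_def)
  have WAB: "W \<subseteq> UA \<inter> UB" using g(9) by (auto simp: UA_def UB_def W0_def)
  define F where "F = (\<lambda>x. if Re (u * x j) \<le> c then F1 x - r x * g1 x else F2 x - r x * g2 x)"
  define h where "h = (\<lambda>x. if Re (u * x j) \<le> c then h1 x - g1 x else h2 x - g2 x)"
  define V where "V = (UA \<inter> {x. Re (u * x j) < c}) \<union> W \<union> (UB \<inter> {x. Re (u * x j) > c})"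
  have eqF: "F1 x - r x * g1 x = F2 x - r x * g2 x" if "x \<in> W" for x
  proof -
    have "F1 x - F2 x = r x * (g1 x - g2 x)" using kF[of x] g(9) g(10)[OF that] that by auto
    then show ?thesis by (simp add: algebra_simps)
  qed
  have eqh: "h1 x - g1 x = h2 x - g2 x" if "x \<in> W \<inter> U" for x
  proof -
    have "x \<in> V1 \<inter> V2 \<inter> U" using that g(9) by (auto simp: W0_def)
    then have "h1 x - h2 x = g1 x - g2 x" using kU[of x] g(10)[of x] that by simp
    then show ?thesis by (simp add: algebra_simps)
  qed
  have "open V" unfolding V_def by (intro open_Un open_Int oAB g(3) open_halfspace_coord)
  moreover have "polyh B Q \<subseteq> V"
  proof
    fix x assume x: "x \<in> polyh B Q"
    consider "Re (u * x j) < c" | "Re (u * x j) = c" | "Re (u * x j) > c" by linarith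
    then show "x \<in> V"
    proof cases
      case 1
      then have "x \<in> polyh (B(j := B j \<inter> {z. Re (u * z) \<le> c})) Q"
        using x unfolding polyh_def by (auto simp del: times_complex.sel)
      then show ?thesis using 1 \<open>polyh _ Q \<subseteq> V1\<close> g(6) by (auto simp: V_def UA_def simp del: times_complex.sel)
    next
      case 2
      then have "x \<in> ?mid"
        using x unfolding polyh_def by (auto simp del: times_complex.sel)
      then show ?thesis using g(8) by (auto simp: V_def)
    next
      case 3
      then have "x \<in> polyh (B(j := B j \<inter> {z. Re (u * z) \<ge> c})) Q"
        using x unfolding polyh_def by (auto simp del: times_complex.sel)
      then show ?thesis using 3 \<open>polyh _ Q \<subseteq> V2\<close> g(7) by (auto simp: V_def UB_def simp del: times_complex.sel)
    qed
  qed
  moreover have "hol F V" unfolding F_def V_def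
    by (rule hol_glue[OF oAB g(3) _ _ WAB eqF])
      (auto simp: UA_def UB_def intro!: hol_diff hol_mult hol_subset[OF r] hol_subset[OF 1(3)]
         hol_subset[OF 2(3)] hol_subset[OF g(4)] hol_subset[OF g(5)])
  moreover have "hol h (V \<inter> U)"
  proof -
    have "hol h (((UA \<inter> U) \<inter> {x. Re (u * x j) < c}) \<union> (W \<inter> U) \<union> ((UB \<inter> U) \<inter> {x. Re (u * x j) > c}))"
      unfolding h_def
      by (rule hol_glue[OF _ _ _ _ _ _ eqh])
       (use oAB g(3) U(1) WAB in \<open>auto simp: UA_def UB_def intro!: hol_diff hol_subset[OF 1(4)]
         hol_subset[OF 2(4)] hol_subset[OF g(4)] hol_subset[OF g(5)]\<close>)
    then show ?thesis by (rule hol_subset) (auto simp: V_def)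
  qed
  moreover have "F y - f y = r y * h y" if "y \<in> V \<inter> U" for y
  proof (cases "Re (u * y j) \<le> c")
    case True
    then have "y \<in> V1 \<inter> U" using that WAB by (auto simp: V_def UA_def simp del: times_complex.sel)
    then show ?thesis using 1(5)[of y] True by (simp add: F_def h_def algebra_simps del: times_complex.sel)
  next
    case False
    then have "y \<in> V2 \<inter> U" using that WAB by (auto simp: V_def UB_def simp del: times_complex.sel)
    then show ?thesis using 2(5)[of y] False by (simp add: F_def h_def algebra_simps del: times_complex.sel)
  qed
  ultimately show ?thesis unfolding extends_def by blast
qed

text \<open>Locally the extension is trivial: near a point of \<open>U\<close> take \<open>f\<close>
  itself with quotient 0; where \<open>r\<close> does not vanish take 0 with quotient - f / r; near
  a point violating a constraint of \<open>Q\<close> the small polyhedra are empty. Box induction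
  glues these pieces by \<open>extends_merge\<close>.\<close>

lemma extends_polyh:
  assumes Q: "splits Q" "\<And>q. q \<in> set Q \<Longrightarrow> hol q UNIV" and B: "\<And>i. compact (B i)" "\<And>i. convex (B i)"
    and U: "open U" "hol f U" and r: "hol r UNIV"
    and zero: "\<And>y. y \<in> polyh B Q \<Longrightarrow> r y = 0 \<Longrightarrow> y \<in> U"
  shows "extends Q r f U B"
proof (rule box_induction[OF B, where P="extends Q r f U"])
  fix C :: "nat \<Rightarrow> complex set" assume "{x. \<forall>i. x i \<in> C i} = {}"
  then have "polyh C Q \<subseteq> {}" by (auto simp: polyh_def)
  then show "extends Q r f U C" unfolding extends_def
    by (intro exI[of _ "\<lambda>_. 0"] exI[of _ "{}"]) auto
next
  fix C :: "nat \<Rightarrow> complex set" and j u c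
  assume C: "\<And>i. compact (C i)" "\<And>i. convex (C i)" "\<And>i. C i \<subseteq> B i" and u: "u \<noteq> 0"
    and e: "extends Q r f U (C(j := C j \<inter> {z. Re (u * z) \<le> c}))"
      "extends Q r f U (C(j := C j \<inter> {z. Re (u * z) \<ge> c}))"
  have "polyh C Q \<subseteq> polyh B Q" using C(3) by (fastforce simp: polyh_def)
  then show "extends Q r f U C"
    by (intro extends_merge[OF Q(1) C(1,2) u U r _ e] zero) auto
next
  fix y assume y: "\<And>i. y i \<in> B i"
  have cont: "continuous_on UNIV r" by (rule hol_continuous[OF r])
  consider "y \<in> U" | "r y \<noteq> 0" | "y \<notin> polyh B Q" using zero by blast
  then show "\<exists>G. open G \<and> y \<in> G \<and> (\<forall>C. {x. \<forall>i. x i \<in> C i} \<subseteq> G \<longrightarrow> extends Q r f U C)"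
  proof cases
    case 1
    have "extends Q r f U C" if "{x. \<forall>i. x i \<in> C i} \<subseteq> U" for C
      unfolding extends_def
    proof (intro exI conjI)
      show "open U" "hol f U" "hol (\<lambda>_. 0) (U \<inter> U)" using U by auto
      show "polyh C Q \<subseteq> U" using that by (auto simp: polyh_def)
    qed auto
    then show ?thesis using 1 U by blast
  next
    case 2
    define V where "V = r -` (- {0})"
    have V: "open V" unfolding V_def by (rule open_vimage[OF _ cont]) auto
    have "extends Q r f U C" if "{x. \<forall>i. x i \<in> C i} \<subseteq> V" for C
      unfolding extends_def
    proof (intro exI conjI)
      show "open V" by fact
      show "polyh C Q \<subseteq> V" using that by (auto simp: polyh_def)
      show "hol (\<lambda>_. 0) V" by simp
      show "hol (\<lambda>y. - f y / r y) (V \<inter> U)"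
        by (intro hol_divide hol_uminus hol_subset[OF r] hol_subset[OF U(2)]) (auto simp: V_def)
    qed (auto simp: V_def)
    then show ?thesis using 2 V by (intro exI[of _ V]) (auto simp: V_def)
  next
    case 3
    then obtain q where q: "q \<in> set Q" "norm (q y) > 1" using y by (force simp: polyh_def)
    define G where "G = q -` (- cball 0 1)"
    have G: "open G" unfolding G_def
      by (rule open_vimage[OF _ hol_continuous[OF Q(2)[OF q(1)]]]) auto
    have "extends Q r f U C" if "{x. \<forall>i. x i \<in> C i} \<subseteq> G" for C
    proof -
      have "polyh C Q \<subseteq> {}" using that q(1) by (force simp: polyh_def G_def)
      then show ?thesis unfolding extends_def
        by (intro exI[of _ "\<lambda>_. 0"] exI[of _ "{}"]) auto
    qed
    then show ?thesis using q G by (intro exI[of _ G]) (auto simp: G_def)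
  qed
qed

section \<open>Approximation on polyhedra\<close>

text \<open>A new variable is always prepended as coordinate 0 by \<open>case_nat\<close>; a
  function of the old variables then reads indices raised by one.\<close>

definition shift :: "((nat \<Rightarrow> complex) \<Rightarrow> complex) \<Rightarrow> (nat \<Rightarrow> complex) \<Rightarrow> complex" where
  "shift q y = q (\<lambda>i. y (Suc i))"

lemma hol_shift: "hol q U \<Longrightarrow> (\<And>y. y \<in> V \<Longrightarrow> (\<lambda>i. y (Suc i)) \<in> U) \<Longrightarrow> hol (shift q) V"
  unfolding shift_def by (rule hol_compose[where U=U]) auto

lemma hol_case_nat: "hol q U \<Longrightarrow> hol (\<lambda>x. case_nat (q x) x i) U"
  by (cases i) auto

text \<open>On the graph the factor \<open>cball 0 1\<close> of coordinate 0 is the constraint given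
  by \<open>q\<close>; this and the converse below let the two polyhedra replace each other.\<close>

lemma polyh_graph:
  "x \<in> polyh B (q # Q) \<Longrightarrow> case_nat (q x) x \<in> polyh (case_nat (cball 0 1) B) (map shift Q)"
  by (auto simp: polyh_def shift_def split: nat.split)

lemma polyh_graphD:
  assumes "y \<in> polyh (case_nat (cball 0 1) B) (map shift Q)" "y 0 = q (\<lambda>i. y (Suc i))"
  shows "(\<lambda>i. y (Suc i)) \<in> polyh B (q # Q)"
proof -
  have "\<And>i. y i \<in> (case i of 0 \<Rightarrow> cball 0 1 | Suc n \<Rightarrow> B n)" using assms(1) by (auto simp: polyh_def)
  from this[of 0] this[of "Suc _"] show ?thesis using assms by (auto simp: polyh_def shift_def)
qed

text \<open>Here r is coordinate 0 minus \<open>q\<close> of the others. Its zeros in the larger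
  polyhedron are the lifted points of \<open>polyh B (q # Q)\<close>, so they lie over
  \<open>U\<close>. On the graph the error term r * h disappears, and \<open>F\<close> takes the
  values of \<open>f\<close>.\<close>

lemma extension_from_graph:
  assumes Q: "splits (map shift Q)" "\<And>p. p \<in> set Q \<Longrightarrow> hol p UNIV" and q: "hol q UNIV"
    and B: "\<And>i. compact (B i)" "\<And>i. convex (B i)" and U: "open U" "hol f U"
    and sub: "polyh B (q # Q) \<subseteq> U"
  obtains F V where "open V" "polyh (case_nat (cball 0 1) B) (map shift Q) \<subseteq> V" "hol F V"
    "\<And>x. x \<in> U \<Longrightarrow> case_nat (q x) x \<in> V \<Longrightarrow> F (case_nat (q x) x) = f x"
proof -
  define r where "r = (\<lambda>y :: nat \<Rightarrow> complex. y 0 - shift q y)"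
  define U' where "U' = {y :: nat \<Rightarrow> complex. (\<lambda>i. y (Suc i)) \<in> U}"
  have "open ((\<lambda>y :: nat \<Rightarrow> complex. (\<lambda>i. y (Suc i))) -` U)"
    by (rule open_vimage[OF U(1)]) (intro continuous_on_coordinatewise_then_product continuous_on_product_coordinates)
  then have oU': "open U'" by (simp add: U'_def vimage_def)
  have B': "compact (case_nat (cball 0 1) B i)" "convex (case_nat (cball (0::complex) 1) B i)" for i
    using B by (auto split: nat.split)
  have hr: "hol r UNIV" unfolding r_def by (intro hol_diff hol_coord hol_shift[OF q]) auto
  have "extends (map shift Q) r (shift f) U' (case_nat (cball 0 1) B)"
  proof (rule extends_polyh[OF Q(1) _ B' oU' _ hr])
    show "hol p UNIV" if "p \<in> set (map shift Q)" for p
      using that Q(2) by (auto intro!: hol_shift[where U=UNIV])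
    show "hol (shift f) U'" by (rule hol_shift[OF U(2)]) (auto simp: U'_def)
    show "y \<in> U'" if "y \<in> polyh (case_nat (cball 0 1) B) (map shift Q)" "r y = 0" for y
    proof -
      have "y 0 = q (\<lambda>i. y (Suc i))" using that(2) by (simp add: r_def shift_def)
      from polyh_graphD[of y B Q q, OF that(1) this] show ?thesis using sub by (auto simp: U'_def)
    qed
  qed
  then obtain F h V where *: "open V" "polyh (case_nat (cball 0 1) B) (map shift Q) \<subseteq> V" "hol F V"
      "\<And>y. y \<in> V \<inter> U' \<Longrightarrow> F y - shift f y = r y * h y"
    unfolding extends_def by blast
  show thesis
  proof (rule that[OF *(1-3)])
    fix x assume "x \<in> U" "case_nat (q x) x \<in> V"
    then have "F (case_nat (q x) x) - shift f (case_nat (q x) x) = r (case_nat (q x) x) * h (case_nat (q x) x)"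
      by (intro *(4)) (simp add: U'_def)
    then show "F (case_nat (q x) x) = f x" by (simp add: r_def shift_def)
  qed
qed

text \<open>\<open>f\<close> near the slice is the restriction to the graph of some \<open>F\<close>
  on a polyhedron with one constraint fewer; splitting \<open>F\<close> there and pulling both parts
  back along the graph map splits \<open>f\<close>. The assumption on \<open>map shift Q\<close>
  enters twice, for the extension and for the splitting.\<close>

lemma splits_Cons:
  assumes Q: "splits (map shift Q)" "\<And>p. p \<in> set Q \<Longrightarrow> hol p UNIV" and q: "hol q UNIV"
  shows "splits (q # Q)"
  unfolding splits_def
proof (intro allI impI, elim conjE)
  fix B :: "nat \<Rightarrow> complex set" and j u c f U
  assume BB: "\<forall>i. compact (B i) \<and> convex (B i)" and u: "u \<noteq> 0" and U: "open U" "hol f U"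
    and sub: "polyh (B(j := B j \<inter> {z. Re (u * z) = c})) (q # Q) \<subseteq> U"
  have B: "compact (B i)" "convex (B i)" for i using BB by auto
  let ?D = "case_nat (cball (0::complex) 1)" and ?B = "\<lambda>X. B(j := B j \<inter> {z. X (Re (u * z))})"
  \<comment> \<open>Coordinate \<open>j\<close> becomes \<open>Suc j\<close> after the new variable
    is prepended, so the cut has to be moved along.\<close>
  have upd: "?D (?B X) = (?D B)(Suc j := ?D B (Suc j) \<inter> {z. X (Re (u * z))})" for X
    by (auto simp: fun_eq_iff split: nat.split)
  note upds = upd[of "\<lambda>t. t \<le> c"] upd[of "\<lambda>t. t \<ge> c"] upd[of "\<lambda>t. t = c"]
  have D: "compact (?D B i)" "convex (?D B i)" for i
    using B by (auto split: nat.split)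
  have eq: "{z. Re (u * z) = c} = (\<lambda>z. Re (u * z)) -` {c}" by auto
  have "closed ((\<lambda>z. Re (u * z)) -` {c})" by (intro closed_vimage continuous_intros closed_singleton)
  moreover have "linear (\<lambda>z. Re (u * z))"
    by (intro bounded_linear.linear bounded_linear_compose[OF bounded_linear_Re] bounded_linear_mult_right)
  \<comment> \<open>The extension is made from the slice alone, because \<open>f\<close> is given
    only near it; the cut factor is again compact and convex.\<close>
  ultimately have M: "compact (?B (\<lambda>t. t = c) i)" "convex (?B (\<lambda>t. t = c) i)" for i
    using B[of j] B[of i] unfolding eq
    by (auto intro!: compact_Int_closed convex_Int convex_linear_vimage)
  obtain F V where F: "open V" "polyh (?D (?B (\<lambda>t. t = c))) (map shift Q) \<subseteq> V" "hol F V"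
    "\<And>x. x \<in> U \<Longrightarrow> case_nat (q x) x \<in> V \<Longrightarrow> F (case_nat (q x) x) = f x"
    by (rule extension_from_graph[of Q q "?B (\<lambda>t. t = c)" U f, OF Q q M U sub]) (assumption | rule that)+
  obtain g1 g2 U1 U2 W where g: "open U1" "open U2" "open W" "hol g1 U1" "hol g2 U2"
        "polyh (?D (?B (\<lambda>t. t \<le> c))) (map shift Q) \<subseteq> U1"
        "polyh (?D (?B (\<lambda>t. t \<ge> c))) (map shift Q) \<subseteq> U2"
        "polyh (?D (?B (\<lambda>t. t = c))) (map shift Q) \<subseteq> W" "W \<subseteq> V \<inter> U1 \<inter> U2"
        "\<And>x. x \<in> W \<Longrightarrow> F x = g1 x - g2 x"
    unfolding upds
    by (rule splitsE[of "map shift Q" "?D B" u V F "Suc j" c, OF Q(1) D u F(1,3) F(2)[unfolded upds]])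
      (rule that[unfolded upds]; assumption)
  define \<psi> where "\<psi> = (\<lambda>x. case_nat (q x) x)"
  have h\<psi>: "hol (\<lambda>x. \<psi> x i) X" for i X
    unfolding \<psi>_def by (rule hol_case_nat[OF hol_subset[OF q]]) auto
  have c\<psi>: "continuous_on UNIV \<psi>"
    using h\<psi> by (intro continuous_on_coordinatewise_then_product hol_continuous)
  have sub\<psi>: "\<psi> x \<in> polyh (?D (?B X)) (map shift Q)" if "x \<in> polyh (?B X) (q # Q)" for x X
    unfolding \<psi>_def by (rule polyh_graph[OF that])
  show "\<exists>g1 g2 U1 U2 W. open U1 \<and> open U2 \<and> open W \<and> hol g1 U1 \<and> hol g2 U2 \<and>
        polyh (B(j := B j \<inter> {z. Re (u * z) \<le> c})) (q # Q) \<subseteq> U1 \<and>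
        polyh (B(j := B j \<inter> {z. Re (u * z) \<ge> c})) (q # Q) \<subseteq> U2 \<and>
        polyh (B(j := B j \<inter> {z. Re (u * z) = c})) (q # Q) \<subseteq> W \<and> W \<subseteq> U \<inter> U1 \<inter> U2 \<and>
        (\<forall>x\<in>W. f x = g1 x - g2 x)"
  proof (intro exI conjI ballI)
    show "open (\<psi> -` U1)" "open (\<psi> -` U2)" using g(1,2) c\<psi> by (auto intro: open_vimage)
    \<comment> \<open>\<open>F\<close> restricted to the graph is known to equal \<open>f\<close>
      only over \<open>U\<close>, hence the intersection.\<close>
    show "open (\<psi> -` W \<inter> U)" using g(3) c\<psi> U(1) by (auto intro!: open_Int open_vimage)
    show "hol (\<lambda>x. g1 (\<psi> x)) (\<psi> -` U1)" by (rule hol_compose[OF g(4) h\<psi>]) auto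
    show "hol (\<lambda>x. g2 (\<psi> x)) (\<psi> -` U2)" by (rule hol_compose[OF g(5) h\<psi>]) auto
    show "polyh (B(j := B j \<inter> {z. Re (u * z) \<le> c})) (q # Q) \<subseteq> \<psi> -` U1"
      using sub\<psi>[of _ "\<lambda>t. t \<le> c"] g(6) by blast
    show "polyh (B(j := B j \<inter> {z. Re (u * z) \<ge> c})) (q # Q) \<subseteq> \<psi> -` U2"
      using sub\<psi>[of _ "\<lambda>t. t \<ge> c"] g(7) by blast
    show "polyh (B(j := B j \<inter> {z. Re (u * z) = c})) (q # Q) \<subseteq> \<psi> -` W \<inter> U"
      using sub\<psi>[of _ "\<lambda>t. t = c"] g(8) sub by blast
    show "\<psi> -` W \<inter> U \<subseteq> U \<inter> \<psi> -` U1 \<inter> \<psi> -` U2" using g(9) by blast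
    fix x assume x: "x \<in> \<psi> -` W \<inter> U"
    then have "\<psi> x \<in> V" using g(9) by blast
    then have "F (\<psi> x) = f x" using F(4)[of x] x by (simp add: \<psi>_def)
    then show "f x = g1 (\<psi> x) - g2 (\<psi> x)" using g(10)[of "\<psi> x"] x by simp
  qed
qed

text \<open>The induction runs over the length and not over the list, since the tail reappears in
  shifted form.\<close>

lemma splits_hol:
  assumes "\<And>q. q \<in> set Q \<Longrightarrow> hol q UNIV"
  shows "splits Q"
  using assms
proof (induction "length Q" arbitrary: Q)
  case 0
  then show ?case by (simp add: splits_Nil)
next
  case (Suc n)
  then obtain q R where Q: "Q = q # R" by (cases Q) auto
  have "splits (map shift R)"
    by (rule Suc.hyps(1)) (use Q Suc.hyps(2) Suc.prems in \<open>auto intro!: hol_shift[where U=UNIV]\<close>)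
  then show ?case unfolding Q by (rule splits_Cons) (use Q Suc.prems in auto)
qed

section \<open>Polynomials in sequence coordinates and approximation on polydiscs\<close>

inductive polyn :: "((nat \<Rightarrow> complex) \<Rightarrow> complex) \<Rightarrow> bool" where
  const: "polyn (\<lambda>x. c)"
| coord: "polyn (\<lambda>x. x i)"
| add: "polyn p \<Longrightarrow> polyn q \<Longrightarrow> polyn (\<lambda>x. p x + q x)"
| mult: "polyn p \<Longrightarrow> polyn q \<Longrightarrow> polyn (\<lambda>x. p x * q x)"

lemma polyn_hol: "polyn p \<Longrightarrow> hol p U"
  by (induction rule: polyn.induct) (auto intro: hol_add hol_mult)

text \<open>Substitution brings an approximating polynomial on the lifted space back to the original
  variables; the inductive form of \<open>polyn\<close> makes it a rule induction.\<close>

lemma polyn_compose: "polyn p \<Longrightarrow> (\<And>i. polyn (\<lambda>x. \<psi> x i)) \<Longrightarrow> polyn (\<lambda>x. p (\<psi> x))"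
  by (induction rule: polyn.induct) (auto intro: polyn.intros)

lemma polyn_power: "polyn p \<Longrightarrow> polyn (\<lambda>x. p x ^ k)"
  by (induction k) (auto intro: polyn.intros)

lemma polyn_sum: "(\<And>i. i \<in> A \<Longrightarrow> polyn (p i)) \<Longrightarrow> polyn (\<lambda>x. \<Sum>i\<in>A. p i x)"
  by (induction A rule: infinite_finite_induct) (auto intro: polyn.intros)

lemma polyn_prod: "(\<And>i. i \<in> A \<Longrightarrow> polyn (p i)) \<Longrightarrow> polyn (\<lambda>x. \<Prod>i\<in>A. p i x)"
  by (induction A rule: infinite_finite_induct) (auto intro: polyn.intros)

text \<open>Geometric series with explicit remainder, which decays uniformly once norm z / norm
  \<zeta> stays below a constant less than 1.\<close>

lemma cauchy_kernel_expansion: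
  fixes z \<zeta> :: complex
  assumes "\<zeta> \<noteq> 0" "\<zeta> \<noteq> z"
  shows "1 / (\<zeta> - z) - (\<Sum>k<m. z ^ k / \<zeta> ^ Suc k) = (z / \<zeta>) ^ m / (\<zeta> - z)"
proof (induction m)
  case (Suc m)
  have "(z / \<zeta>) ^ m / (\<zeta> - z) - z ^ m / \<zeta> ^ Suc m = (z / \<zeta>) ^ Suc m / (\<zeta> - z)"
    using assms by (simp add: field_simps)
  then show ?case using Suc by (simp add: algebra_simps)
qed auto

text \<open>Taylor expansion in the single variable \<open>x n\<close>. The coefficients do not
  depend on that variable and are holomorphic on a whole neighbourhood of the polydisc, so that they
  can be approximated in turn.\<close>

lemma approx_disc:
  assumes R: "\<And>i. R i \<ge> 0" and U: "open U" "hol f U"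
    and sub: "{x. \<forall>i. norm (x i) \<le> R i} \<subseteq> U" and e: "e > 0"
  obtains N m c where "open N" "{x. \<forall>i. norm (x i) \<le> R i} \<subseteq> N" "\<And>k. hol (c k) N"
    "\<And>k x \<zeta>. c k (x(n := \<zeta>)) = c k x"
    "\<And>x. (\<forall>i. norm (x i) \<le> R i) \<Longrightarrow> norm (f x - (\<Sum>k<(m::nat). x n ^ k * c k x)) < e"
proof -
  define K where "K = {x :: nat \<Rightarrow> complex. \<forall>i. norm (x i) \<le> R i}"
  have K: "compact K" using compact_product[of "\<lambda>i. cball (0::complex) (R i)"] by (simp add: K_def)
  have inU: "x(n := \<zeta>) \<in> U" if "x \<in> K" "\<zeta> \<in> cball 0 (R n)" for x \<zeta>
    using that by (intro subsetD[OF sub]) (auto simp: K_def)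
  obtain N V where N: "open N" "open V" "K \<subseteq> N" "cball 0 (R n) \<subseteq> V"
    and NV: "\<And>x \<zeta>. x \<in> N \<Longrightarrow> \<zeta> \<in> V \<Longrightarrow> x(n := \<zeta>) \<in> U"
    using tube[of K "cball 0 (R n)" U n thesis] K U(1) inU by (simp add: compact_cball)
  obtain d where d: "d > 0" "\<And>x. x \<in> cball 0 (R n) \<Longrightarrow> ball x d \<subseteq> V"
    using compact_ball_subset_open[OF compact_cball N(2,4)] by blast
  \<comment> \<open>A circle strictly larger than the disc of radius \<open>R n\<close> but still
    inside \<open>V\<close>: the excess gives the ratio \<open>R n / \<rho> < 1\<close> that drives
    the convergence.\<close>
  define \<rho> where "\<rho> = R n + d / 2"
  have \<rho>: "\<rho> > R n" "\<rho> > 0" using d R[of n] by (auto simp: \<rho>_def intro: add_nonneg_pos)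
  have \<rho>V: "cball 0 \<rho> \<subseteq> V"
  proof
    fix z :: complex assume z: "z \<in> cball 0 \<rho>"
    show "z \<in> V"
    proof (cases "norm z \<le> R n")
      case True
      then show ?thesis using N(4) by auto
    next
      case False
      \<comment> \<open>The radial projection of \<open>z\<close> to the circle of radius
        \<open>R n\<close>, at distance norm z - R n from \<open>z\<close>.\<close>
      define w where "w = of_real (R n / norm z) * z"
      have nz: "norm z > 0" using False R[of n] by linarith
      have nw: "norm w = R n" using nz R[of n] by (simp add: w_def norm_mult norm_divide)
      have "w - z = of_real (R n / norm z - 1) * z" by (simp add: w_def algebra_simps)
      then have "dist w z = \<bar>R n / norm z - 1\<bar> * norm z" by (simp only: dist_norm norm_mult norm_of_real)
      also have "\<dots> = norm z - R n" using False nz by (simp add: abs_if field_simps)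
      also have "\<dots> < d" using z d by (simp add: \<rho>_def)
      finally have "z \<in> ball w d" by simp
      then show ?thesis using d(2)[of w] nw by auto
    qed
  qed
  define c where "c = (\<lambda>k x. contour_integral (circlepath 0 \<rho>) (\<lambda>\<zeta>. f (x(n := \<zeta>)) / \<zeta> ^ Suc k) / (2 * of_real pi * \<i>))"
  have sph: "path_image (circlepath 0 \<rho>) = sphere 0 \<rho>" using \<rho> by simp
  have contf: "continuous_on (N \<times> sphere 0 \<rho>) (\<lambda>p. f ((fst p)(n := snd p)))"
    using \<rho>V by (intro continuous_on_compose2[OF hol_continuous[OF U(2)] continuous_on_update]) (auto intro!: NV)
  have hc: "hol (c k) N" for k
    unfolding c_def
  proof (intro hol_divide hol_const hol_contour_integral)
    show "continuous_on {0..1} (\<lambda>s. vector_derivative (circlepath 0 \<rho>) (at s))"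
      by (simp add: vector_derivative_circlepath) (intro continuous_intros)
    show "continuous_on (N \<times> path_image (circlepath 0 \<rho>)) (\<lambda>(x, \<zeta>). f (x(n := \<zeta>)) / \<zeta> ^ Suc k)"
      unfolding sph case_prod_beta using \<rho>
      by (intro continuous_on_divide contf continuous_intros) auto
    show "hol (\<lambda>x. f (x(n := \<zeta>))) N" if "\<zeta> \<in> path_image (circlepath 0 \<rho>)" for \<zeta>
      using that \<rho>V unfolding sph by (intro hol_update[OF U(2)] NV) auto
  qed (use \<rho> in auto)
  have "compact ((\<lambda>p. f ((fst p)(n := snd p))) ` (K \<times> sphere 0 \<rho>))"
    by (intro compact_continuous_image continuous_on_subset[OF contf] compact_Times K compact_sphere) (use N(3) in auto)
  then obtain M where M: "M > 0" "\<And>x \<zeta>. x \<in> K \<Longrightarrow> \<zeta> \<in> sphere 0 \<rho> \<Longrightarrow> norm (f (x(n := \<zeta>))) \<le> M"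
    by (force dest!: compact_imp_bounded simp: bounded_pos)
  \<comment> \<open>Apart from the power of \<open>R n / \<rho>\<close>, this is the bound of the
    remainder times the length \<open>2 * pi * \<rho>\<close> of the circle, divided by the
    \<open>2 * pi\<close> of Cauchy's formula.\<close>
  define A where "A = M / (\<rho> - R n) * \<rho>"
  have "A > 0" using M \<rho> by (simp add: A_def)
  have "(\<lambda>m. (R n / \<rho>) ^ m) \<longlonglongrightarrow> 0" using \<rho> R[of n] by (intro LIMSEQ_realpow_zero) auto
  then have "eventually (\<lambda>m. (R n / \<rho>) ^ m < e / A) sequentially"
    using e \<open>A > 0\<close> by (intro order_tendstoD(2)) auto
  then obtain m where m: "(R n / \<rho>) ^ m < e / A" by (auto simp: eventually_sequentially)
  show thesis
  proof (rule that[of N c m])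
    show "open N" "{x. \<forall>i. norm (x i) \<le> R i} \<subseteq> N" using N by (auto simp: K_def)
    show "hol (c k) N" for k by (rule hc)
    show "c k (x(n := \<zeta>)) = c k x" for k x \<zeta> by (simp add: c_def)
    fix x :: "nat \<Rightarrow> complex" assume "\<forall>i. norm (x i) \<le> R i"
    then have x: "x \<in> K" and xn: "norm (x n) \<le> R n" by (auto simp: K_def)
    let ?f = "\<lambda>\<zeta>. f (x(n := \<zeta>))" and ?I = "2 * of_real pi * \<i> :: complex"
    have xN: "x \<in> N" using x N by auto
    have "?f holomorphic_on V" by (rule holomorphic_update[OF U(2) N(2)]) (rule NV[OF xN])
    then have hf: "?f holomorphic_on cball 0 \<rho>" using \<rho>V by (rule holomorphic_on_subset)
    have "((\<lambda>\<zeta>. ?f \<zeta> / (\<zeta> - x n)) has_contour_integral ?I * ?f (x n)) (circlepath 0 \<rho>)"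
      by (rule Cauchy_integral_circlepath_simple[OF hf]) (use xn \<rho> in auto)
    then have 1: "((\<lambda>\<zeta>. ?f \<zeta> / (\<zeta> - x n)) has_contour_integral ?I * f x) (circlepath 0 \<rho>)" by simp
    have cf: "continuous_on (sphere 0 \<rho>) ?f"
      by (rule continuous_on_subset[OF holomorphic_on_imp_continuous_on[OF hf]]) auto
    have "(\<lambda>\<zeta>. ?f \<zeta> / \<zeta> ^ Suc k) contour_integrable_on circlepath 0 \<rho>" for k
      using \<rho> by (intro contour_integrable_continuous_circlepath continuous_on_divide) (auto intro!: continuous_intros cf)
    then have "((\<lambda>\<zeta>. ?f \<zeta> / \<zeta> ^ Suc k) has_contour_integral ?I * c k x) (circlepath 0 \<rho>)" for k
      using has_contour_integral_integral by (fastforce simp: c_def)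
    then have "((\<lambda>\<zeta>. \<Sum>k<m. x n ^ k * (?f \<zeta> / \<zeta> ^ Suc k)) has_contour_integral (\<Sum>k<m. x n ^ k * (?I * c k x))) (circlepath 0 \<rho>)"
      by (intro has_contour_integral_sum has_contour_integral_lmul) auto
    then have 2: "((\<lambda>\<zeta>. ?f \<zeta> / (\<zeta> - x n) - (\<Sum>k<m. x n ^ k * (?f \<zeta> / \<zeta> ^ Suc k))) has_contour_integral
        ?I * f x - (\<Sum>k<m. x n ^ k * (?I * c k x))) (circlepath 0 \<rho>)"
      by (rule has_contour_integral_diff[OF 1])
    have "norm (?I * f x - (\<Sum>k<m. x n ^ k * (?I * c k x))) \<le> (M * (R n / \<rho>) ^ m / (\<rho> - R n)) * (2 * pi * \<rho>)"
    proof (rule has_contour_integral_bound_circlepath[OF 2])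
      show "0 \<le> M * (R n / \<rho>) ^ m / (\<rho> - R n)" using M \<rho> R[of n] by simp
      fix \<zeta> :: complex assume "norm (\<zeta> - 0) = \<rho>"
      then have \<zeta>: "norm \<zeta> = \<rho>" by simp
      then have ne: "\<zeta> \<noteq> 0" "\<zeta> \<noteq> x n" using \<rho> xn by auto
      have "?f \<zeta> / (\<zeta> - x n) - (\<Sum>k<m. x n ^ k * (?f \<zeta> / \<zeta> ^ Suc k))
          = ?f \<zeta> * (1 / (\<zeta> - x n) - (\<Sum>k<m. x n ^ k / \<zeta> ^ Suc k))"
        by (simp add: right_diff_distrib sum_distrib_left mult.commute)
      also have "\<dots> = ?f \<zeta> * ((x n / \<zeta>) ^ m / (\<zeta> - x n))"
        by (simp only: cauchy_kernel_expansion[OF ne])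
      finally have "norm (?f \<zeta> / (\<zeta> - x n) - (\<Sum>k<m. x n ^ k * (?f \<zeta> / \<zeta> ^ Suc k)))
          = norm (?f \<zeta>) * ((norm (x n) / \<rho>) ^ m / norm (\<zeta> - x n))"
        using \<zeta> by (simp add: norm_mult norm_divide norm_power)
      also have "\<dots> \<le> M * ((R n / \<rho>) ^ m / (\<rho> - R n))"
      proof (intro mult_mono frac_le power_mono divide_right_mono)
        show "norm (?f \<zeta>) \<le> M" using M(2)[OF x, of \<zeta>] \<zeta> by simp
        show "\<rho> - R n \<le> norm (\<zeta> - x n)" using norm_triangle_ineq2[of \<zeta> "x n"] \<zeta> xn by linarith
      qed (use M \<rho> xn R[of n] in auto)
      finally show "norm (?f \<zeta> / (\<zeta> - x n) - (\<Sum>k<m. x n ^ k * (?f \<zeta> / \<zeta> ^ Suc k))) \<le> M * (R n / \<rho>) ^ m / (\<rho> - R n)"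
        by simp
    qed (use \<rho> in auto)
    moreover have "?I * f x - (\<Sum>k<m. x n ^ k * (?I * c k x)) = ?I * (f x - (\<Sum>k<m. x n ^ k * c k x))"
      by (simp add: right_diff_distrib sum_distrib_left mult_ac)
    moreover have "norm (?I * (f x - (\<Sum>k<m. x n ^ k * c k x))) = 2 * pi * norm (f x - (\<Sum>k<m. x n ^ k * c k x))"
      by (simp add: norm_mult)
    moreover have "(M * (R n / \<rho>) ^ m / (\<rho> - R n)) * (2 * pi * \<rho>) = 2 * pi * (A * (R n / \<rho>) ^ m)"
      by (simp add: A_def)
    ultimately have "2 * pi * norm (f x - (\<Sum>k<m. x n ^ k * c k x)) \<le> 2 * pi * (A * (R n / \<rho>) ^ m)"
      by metis
    then have "norm (f x - (\<Sum>k<m. x n ^ k * c k x)) \<le> A * (R n / \<rho>) ^ m" by simp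
    also have "\<dots> < e" using m \<open>A > 0\<close> by (simp add: field_simps)
    finally show "norm (f x - (\<Sum>k<m. x n ^ k * c k x)) < e" .
  qed
qed

text \<open>Induction on the number of variables: with all radii 0 the polydisc is a point.
  Otherwise the Taylor coefficients in \<open>x n\<close> are approximated on the polydisc with
  radius \<open>n\<close> set to 0, which loses nothing as they ignore \<open>x n\<close>.\<close>

lemma approx_polydisc:
  assumes "\<And>i. R i \<ge> 0" "\<And>i. i \<ge> n \<Longrightarrow> R i = 0" "open U" "hol f U"
    "{x. \<forall>i. norm (x i) \<le> R i} \<subseteq> U" "e > 0"
  shows "\<exists>p. polyn p \<and> (\<forall>x. (\<forall>i. norm (x i) \<le> R i) \<longrightarrow> norm (f x - p x) < e)"
  using assms
proof (induction n arbitrary: R f U e)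
  case 0
  have "x = (\<lambda>_. 0)" if "\<forall>i. norm (x i) \<le> R i" for x :: "nat \<Rightarrow> complex"
    using that 0(2) by (auto simp: fun_eq_iff)
  then have "norm (f x - f (\<lambda>_. 0)) < e" if "\<forall>i. norm (x i) \<le> R i" for x
    using that 0(6) by simp
  then show ?case using polyn.const[of "f (\<lambda>_. 0)"] by blast
next
  case (Suc n)
  obtain N m c where N: "open N" "{x. \<forall>i. norm (x i) \<le> R i} \<subseteq> N" and hc: "\<And>k. hol (c k) N"
    and cn: "\<And>k x \<zeta>. c k (x(n := \<zeta>)) = c k x"
    and appr: "\<And>x. (\<forall>i. norm (x i) \<le> R i) \<Longrightarrow> norm (f x - (\<Sum>k<(m::nat). x n ^ k * c k x)) < e / 2"
    by (rule approx_disc[OF Suc.prems(1,3,4,5), of "e / 2" n]) (use Suc.prems in auto)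
  \<comment> \<open>The summand 1 keeps \<open>S\<close> positive when \<open>m = 0\<close>; the
    coefficient errors then add up to at most \<open>(S - 1) * \<eta>\<close>, which is at most
    \<open>e / 2\<close>.\<close>
  define S where "S = (\<Sum>k<m. R n ^ k) + 1"
  have "(\<Sum>k<m. R n ^ k) \<ge> 0" using Suc.prems(1) by (intro sum_nonneg) auto
  then have S: "S > 0" by (simp add: S_def)
  define \<eta> where "\<eta> = e / (2 * S)"
  have \<eta>: "\<eta> > 0" using S Suc.prems by (simp add: \<eta>_def)
  have "\<exists>p. polyn p \<and> (\<forall>x. (\<forall>i. norm (x i) \<le> (R(n := 0)) i) \<longrightarrow> norm (c k x - p x) < \<eta>)" for k
  proof (rule Suc.IH[OF _ _ N(1) hc _ \<eta>])
    show "(R(n := 0)) i = 0" if "i \<ge> n" for i using Suc.prems(2)[of i] that by (cases "i = n") auto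
    have "norm (x i) \<le> R i" if "\<forall>i. norm (x i) \<le> (R(n := 0)) i" for x :: "nat \<Rightarrow> complex" and i
      using that[rule_format, of i] Suc.prems(1)[of i] by (auto split: if_splits)
    then show "{x. \<forall>i. norm (x i) \<le> (R(n := 0)) i} \<subseteq> N" using N(2) by blast
  qed (use Suc.prems(1) in auto)
  then obtain p where p: "\<And>k. polyn (p k)"
    "\<And>k x. \<forall>i. norm (x i) \<le> (R(n := 0)) i \<Longrightarrow> norm (c k x - p k x) < \<eta>" by metis
  define P where "P = (\<lambda>x. \<Sum>k<m. x n ^ k * p k (x(n := 0)))"
  have upd: "polyn (\<lambda>x. (x(n := 0)) i)" for i
    by (cases "i = n") (auto intro: polyn.intros)
  have "polyn P" unfolding P_def
    by (intro polyn_sum polyn.mult polyn_power polyn.coord polyn_compose[OF p(1) upd])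
  moreover have "norm (f x - P x) < e" if x: "\<forall>i. norm (x i) \<le> R i" for x
  proof -
    have "norm ((\<Sum>k<m. x n ^ k * c k x) - P x) = norm (\<Sum>k<m. x n ^ k * (c k (x(n := 0)) - p k (x(n := 0))))"
      by (simp add: P_def cn sum_subtractf right_diff_distrib)
    also have "\<dots> \<le> (\<Sum>k<m. R n ^ k * \<eta>)"
    proof (rule sum_norm_le)
      fix k
      have "norm (c k (x(n := 0)) - p k (x(n := 0))) < \<eta>" using x by (intro p(2)) auto
      then show "norm (x n ^ k * (c k (x(n := 0)) - p k (x(n := 0)))) \<le> R n ^ k * \<eta>"
        unfolding norm_mult norm_power using x Suc.prems(1)[of n]
        by (intro mult_mono power_mono) auto
    qed
    also have "\<dots> = (S - 1) * \<eta>" by (simp add: S_def sum_distrib_right)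
    also have "\<dots> \<le> e / 2" using S Suc.prems by (simp add: \<eta>_def field_simps)
    finally have "norm ((\<Sum>k<m. x n ^ k * c k x) - P x) \<le> e / 2" .
    with appr[OF x] have "norm ((f x - (\<Sum>k<m. x n ^ k * c k x)) + ((\<Sum>k<m. x n ^ k * c k x) - P x)) < e"
      by (intro norm_triangle_lt) linarith
    then show ?thesis by simp
  qed
  ultimately show ?case by blast
qed

text \<open>Substituting \<open>q x\<close> for the new variable in a polynomial close to the
  extension gives a polynomial again. Each constraint is traded for one more coordinate of radius 1,
  so \<open>n\<close> becomes \<open>Suc n\<close> while the list shrinks.\<close>

theorem oka_weil_polyhedron:
  assumes "\<And>q. q \<in> set Q \<Longrightarrow> polyn q" "\<And>i. R i \<ge> 0" "\<And>i. i \<ge> n \<Longrightarrow> R i = 0" "open U" "hol f U"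
    "polyh (\<lambda>i. cball 0 (R i)) Q \<subseteq> U" "e > 0"
  shows "\<exists>p. polyn p \<and> (\<forall>x\<in>polyh (\<lambda>i. cball 0 (R i)) Q. norm (f x - p x) < e)"
  using assms
proof (induction "length Q" arbitrary: Q R n f U)
  case 0
  then have Q: "polyh (\<lambda>i. cball 0 (R i)) Q = {x. \<forall>i. norm (x i) \<le> R i}" by (auto simp: polyh_def)
  show ?case using approx_polydisc[of R n U f e] 0 unfolding Q by auto
next
  case (Suc l)
  obtain q P where Q: "Q = q # P" using Suc.hyps(2) by (cases Q) auto
  have q: "polyn q" and P: "\<And>p. p \<in> set P \<Longrightarrow> polyn p" using Suc.prems(1) Q by auto
  have sP: "polyn (shift p)" if "p \<in> set P" for p
    unfolding shift_def by (rule polyn_compose[OF P[OF that] polyn.coord])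
  have eqR: "case_nat (cball 0 1) (\<lambda>i. cball 0 (R i)) = (\<lambda>i. cball (0::complex) (case_nat 1 R i))"
    by (auto simp: fun_eq_iff split: nat.split)
  obtain F V where F: "open V" "polyh (case_nat (cball 0 1) (\<lambda>i. cball 0 (R i))) (map shift P) \<subseteq> V" "hol F V"
    "\<And>x. x \<in> U \<Longrightarrow> case_nat (q x) x \<in> V \<Longrightarrow> F (case_nat (q x) x) = f x"
    by (rule extension_from_graph[of P q "\<lambda>i. cball 0 (R i)" U f])
      (use P q sP Suc.prems Q in \<open>auto intro!: splits_hol polyn_hol\<close>)
  have "\<exists>p. polyn p \<and> (\<forall>x\<in>polyh (\<lambda>i. cball 0 (case_nat 1 R i)) (map shift P). norm (F x - p x) < e)"
  proof (rule Suc.hyps(1)[where n="Suc n"])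
    show "case_nat 1 R i \<ge> 0" for i using Suc.prems(2) by (auto split: nat.split)
    show "case_nat 1 R i = 0" if "i \<ge> Suc n" for i using Suc.prems(3) that by (auto split: nat.split)
  qed (use Suc.hyps(2) Q sP F Suc.prems(7) eqR in auto)
  then obtain p where p: "polyn p"
    "\<And>x. x \<in> polyh (case_nat (cball 0 1) (\<lambda>i. cball 0 (R i))) (map shift P) \<Longrightarrow> norm (F x - p x) < e"
    unfolding eqR by blast
  have "polyn (\<lambda>x. case_nat (q x) x i)" for i by (cases i) (auto intro: q polyn.coord)
  then have "polyn (\<lambda>x. p (case_nat (q x) x))" by (rule polyn_compose[OF p(1)])
  moreover have "norm (f x - p (case_nat (q x) x)) < e" if x: "x \<in> polyh (\<lambda>i. cball 0 (R i)) Q" for x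
  proof -
    have g: "case_nat (q x) x \<in> polyh (case_nat (cball 0 1) (\<lambda>i. cball 0 (R i))) (map shift P)"
      using x unfolding Q by (rule polyh_graph)
    have "F (case_nat (q x) x) = f x" using x g F(2) Suc.prems(6) by (intro F(4)) auto
    then show ?thesis using p(2)[OF g] by simp
  qed
  ultimately show ?case by blast
qed

section \<open>The Oka--Weil theorem\<close>

definition cn_monom :: "('n \<Rightarrow> nat) \<Rightarrow> complex^'n \<Rightarrow> complex" where
  "cn_monom \<alpha> z = (\<Prod>i\<in>UNIV. (z $ i) ^ (\<alpha> i))"

text \<open>With an arbitrary finite index set, sums and products can be formed without tracking
  which coefficients cancel.\<close>

lemma polyfun_cn_iff:
  "polyfun_cn q \<longleftrightarrow> (\<exists>S c. finite S \<and> (\<forall>z. q z = (\<Sum>\<alpha>\<in>S. c \<alpha> * cn_monom \<alpha> z)))"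
proof
  assume "polyfun_cn q"
  then show "\<exists>S c. finite S \<and> (\<forall>z. q z = (\<Sum>\<alpha>\<in>S. c \<alpha> * cn_monom \<alpha> z))"
    unfolding polyfun_cn_def cn_monom_def by blast
next
  assume "\<exists>S c. finite S \<and> (\<forall>z. q z = (\<Sum>\<alpha>\<in>S. c \<alpha> * cn_monom \<alpha> z))"
  then obtain S c where S: "finite S" "\<And>z. q z = (\<Sum>\<alpha>\<in>S. c \<alpha> * cn_monom \<alpha> z)" by blast
  define d where "d = (\<lambda>\<alpha>. if \<alpha> \<in> S then c \<alpha> else 0)"
  have fin: "{\<alpha>. d \<alpha> \<noteq> 0} \<subseteq> S" by (auto simp: d_def)
  have "q z = (\<Sum>\<alpha>\<in>{\<alpha>. d \<alpha> \<noteq> 0}. d \<alpha> * (\<Prod>i\<in>UNIV. (z $ i) ^ (\<alpha> i)))" for z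
    unfolding S(2) cn_monom_def
    by (rule sum.mono_neutral_cong_right[OF S(1) fin]) (auto simp: d_def)
  then show "polyfun_cn q"
    unfolding polyfun_cn_def using finite_subset[OF fin S(1)] by blast
qed

lemma polyfun_cn_monom: "polyfun_cn (\<lambda>z. c * cn_monom \<alpha> z)"
  unfolding polyfun_cn_iff by (rule exI[of _ "{\<alpha>}"]) (auto intro: exI[of _ "\<lambda>_. c"])

lemma polyfun_cn_add:
  assumes "polyfun_cn p" "polyfun_cn q"
  shows "polyfun_cn (\<lambda>z. p z + q z)"
proof -
  obtain S c where S: "finite S" "\<And>z. p z = (\<Sum>\<alpha>\<in>S. c \<alpha> * cn_monom \<alpha> z)"
    using assms(1) unfolding polyfun_cn_iff by blast
  obtain T d where T: "finite T" "\<And>z. q z = (\<Sum>\<alpha>\<in>T. d \<alpha> * cn_monom \<alpha> z)"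
    using assms(2) unfolding polyfun_cn_iff by blast
  have "p z + q z = (\<Sum>\<alpha>\<in>S \<union> T. ((if \<alpha> \<in> S then c \<alpha> else 0) + (if \<alpha> \<in> T then d \<alpha> else 0)) * cn_monom \<alpha> z)" for z
  proof -
    have "p z = (\<Sum>\<alpha>\<in>S \<union> T. (if \<alpha> \<in> S then c \<alpha> else 0) * cn_monom \<alpha> z)"
      unfolding S(2) using S(1) T(1) by (intro sum.mono_neutral_cong_left) auto
    moreover have "q z = (\<Sum>\<alpha>\<in>S \<union> T. (if \<alpha> \<in> T then d \<alpha> else 0) * cn_monom \<alpha> z)"
      unfolding T(2) using S(1) T(1) by (intro sum.mono_neutral_cong_left) auto
    ultimately show ?thesis by (simp add: sum.distrib distrib_right)
  qed
  then show ?thesis unfolding polyfun_cn_iff using S(1) T(1)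
    by (intro exI[of _ "S \<union> T"] exI[of _ "\<lambda>\<alpha>. (if \<alpha> \<in> S then c \<alpha> else 0) + (if \<alpha> \<in> T then d \<alpha> else 0)"]) auto
qed

lemma polyfun_cn_const: "polyfun_cn (\<lambda>z. c)"
  using polyfun_cn_monom[of c "\<lambda>_. 0"] by (simp add: cn_monom_def)

lemma polyfun_cn_sum: "(\<And>i. i \<in> A \<Longrightarrow> polyfun_cn (p i)) \<Longrightarrow> polyfun_cn (\<lambda>z. \<Sum>i\<in>A. p i z)"
  by (induction A rule: infinite_finite_induct) (auto intro: polyfun_cn_add polyfun_cn_const)

lemma polyfun_cn_mult:
  assumes "polyfun_cn p" "polyfun_cn q"
  shows "polyfun_cn (\<lambda>z. p z * q z)"
proof -
  obtain S c where S: "finite S" "\<And>z. p z = (\<Sum>\<alpha>\<in>S. c \<alpha> * cn_monom \<alpha> z)"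
    using assms(1) unfolding polyfun_cn_iff by blast
  obtain T d where T: "finite T" "\<And>z. q z = (\<Sum>\<alpha>\<in>T. d \<alpha> * cn_monom \<alpha> z)"
    using assms(2) unfolding polyfun_cn_iff by blast
  have "cn_monom \<alpha> z * cn_monom \<beta> z = cn_monom (\<lambda>i. \<alpha> i + \<beta> i) z" for \<alpha> \<beta> :: "'a \<Rightarrow> nat" and z
    by (simp add: cn_monom_def power_add prod.distrib)
  then have "p z * q z = (\<Sum>\<alpha>\<in>S. \<Sum>\<beta>\<in>T. (c \<alpha> * d \<beta>) * cn_monom (\<lambda>i. \<alpha> i + \<beta> i) z)" for z
    unfolding S(2) T(2) sum_product by (intro sum.cong refl) (metis mult.assoc mult.left_commute)
  then show ?thesis by (simp add: polyfun_cn_sum polyfun_cn_monom)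
qed

lemma polyfun_cn_coord: "polyfun_cn (\<lambda>z. z $ i)"
proof -
  have "cn_monom (\<lambda>j. if j = i then 1 else 0) z = z $ i" for z :: "complex^'a"
    by (simp add: cn_monom_def if_distrib[of "\<lambda>k. _ ^ k"] prod.delta cong: if_cong)
  then show ?thesis using polyfun_cn_monom[of 1 "\<lambda>j. if j = i then 1 else 0"] by simp
qed

lemma continuous_on_cn_monom: "continuous_on A (cn_monom \<alpha>)"
  unfolding cn_monom_def by (intro continuous_intros continuous_on_component)

lemma polyfun_cn_continuous: "polyfun_cn q \<Longrightarrow> continuous_on A q"
proof -
  assume "polyfun_cn q"
  then obtain S c where S: "finite S" "\<And>z. q z = (\<Sum>\<alpha>\<in>S. c \<alpha> * cn_monom \<alpha> z)"
    unfolding polyfun_cn_iff by blast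
  have "continuous_on A (\<lambda>z. \<Sum>\<alpha>\<in>S. c \<alpha> * cn_monom \<alpha> z)"
    by (intro continuous_intros continuous_on_cn_monom)
  then show ?thesis using S(2) by (metis (no_types, lifting) continuous_on_cong)
qed

lemma polyn_polyfun_cn:
  assumes "polyn p" "\<And>i. polyfun_cn (\<lambda>z. \<iota> z i)"
  shows "polyfun_cn (\<lambda>z. p (\<iota> z))"
  using assms(1)
  by (induction rule: polyn.induct) (auto intro: polyfun_cn_const polyfun_cn_add polyfun_cn_mult assms(2))

lemma polyfun_cn_polyn:
  assumes "polyfun_cn q"
  shows "polyn (\<lambda>x. q (\<chi> i. x (idx i)))"
proof -
  obtain S c where S: "finite S" "\<And>z. q z = (\<Sum>\<alpha>\<in>S. c \<alpha> * cn_monom \<alpha> z)"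
    using assms unfolding polyfun_cn_iff by blast
  show ?thesis unfolding S(2) cn_monom_def
    by (intro polyn_sum polyn.mult polyn.const polyn_prod) (simp add: polyn_power polyn.coord)
qed

lemma continuous_on_vec_of_fun: "continuous_on A (\<lambda>x :: nat \<Rightarrow> complex. \<chi> i. x (idx i))"
  by (intro continuous_intros continuous_on_subset[OF continuous_on_product_coordinates]) auto

text \<open>The chain rule along a curve with velocity d gives the derivative s \<mapsto> D (s d),
  where D is a priori only real-linear; its homogeneity under complex scalars turns this into
  multiplication by D d.\<close>

lemma hol_cn:
  fixes h :: "complex^'n \<Rightarrow> complex" and idx :: "'n \<Rightarrow> nat"
  assumes h: "holomorphic_cn h U"
  shows "hol (\<lambda>x. h (\<chi> i. x (idx i))) {x. (\<chi> i. x (idx i)) \<in> U}"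
  unfolding hol_def
proof (intro conjI allI impI)
  have ch: "continuous_on U h"
    using h unfolding holomorphic_cn_def
    by (meson continuous_at_imp_continuous_on has_derivative_continuous)
  show "continuous_on {x. (\<chi> i. x (idx i)) \<in> U} (\<lambda>x. h (\<chi> i. x (idx i)))"
    by (rule continuous_on_compose2[OF ch continuous_on_vec_of_fun]) auto
  fix \<phi> :: "complex \<Rightarrow> nat \<Rightarrow> complex" and T
  assume *: "open T \<and> \<phi> ` T \<subseteq> {x. (\<chi> i. x (idx i)) \<in> U} \<and> (\<forall>i. (\<lambda>t. \<phi> t i) holomorphic_on T)"
  show "(\<lambda>t. h (\<chi> i. \<phi> t (idx i))) holomorphic_on T"
  proof (rule holomorphic_onI)
    fix t assume t: "t \<in> T"
    have "\<exists>d. ((\<lambda>t. \<phi> t j) has_field_derivative d) (at t)" for j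
      using * t by (meson field_differentiable_def holomorphic_on_imp_differentiable_at)
    then obtain d where d: "\<And>j. ((\<lambda>t. \<phi> t j) has_derivative (\<lambda>s. d j * s)) (at t)"
      unfolding has_field_derivative_def by metis
    have ax: "linear (axis i :: complex \<Rightarrow> complex^'n)" for i
      by (rule linearI) (auto simp: axis_def vec_eq_iff)
    then have axb: "bounded_linear (axis i :: complex \<Rightarrow> complex^'n)" for i
      by (simp add: linear_conv_bounded_linear)
    have "((\<lambda>t. \<Sum>i\<in>UNIV. axis i (\<phi> t (idx i))) has_derivative (\<lambda>s. \<Sum>i\<in>UNIV. axis i (d (idx i) * s))) (at t)"
      by (intro has_derivative_sum bounded_linear.has_derivative[OF axb d])
    moreover have ax_sum: "(\<Sum>i\<in>UNIV. axis i (v i)) = (\<chi> i. v i)" for v :: "'n \<Rightarrow> complex"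
      by (simp add: vec_eq_iff axis_def sum.delta)
    ultimately have der: "((\<lambda>t. \<chi> i. \<phi> t (idx i)) has_derivative (\<lambda>s. \<chi> i. s * (\<chi> i. d (idx i)) $ i)) (at t)"
      by (simp add: mult.commute)
    obtain D where D: "(h has_derivative D) (at (\<chi> i. \<phi> t (idx i)))" "\<And>c v. D (\<chi> i. c * v $ i) = c * D v"
      using h * t unfolding holomorphic_cn_def by blast
    have "((\<lambda>t. h (\<chi> i. \<phi> t (idx i))) has_derivative (\<lambda>s. D (\<chi> i. s * (\<chi> i. d (idx i)) $ i))) (at t)"
      using has_derivative_compose[OF der D(1)] .
    then have "((\<lambda>t. h (\<chi> i. \<phi> t (idx i))) has_field_derivative D (\<chi> i. d (idx i))) (at t)"
      unfolding D(2) has_field_derivative_def by (subst (asm) mult.commute)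
    then show "(\<lambda>t. h (\<chi> i. \<phi> t (idx i))) field_differentiable at t within T"
      using field_differentiable_at_within field_differentiable_def by blast
  qed
qed

text \<open>A point of the polydisc \<open>X\<close> outside the neighbourhood is not in
  \<open>K\<close>, so by polynomial convexity some polynomial bounded by 1 on \<open>K\<close>
  exceeds 1 there, and also nearby. By compactness finitely many such polynomials cut out of
  \<open>X\<close> a polyhedron that contains \<open>K\<close> and lies in the
  neighbourhood.\<close>

theorem oka_weil:
  fixes K :: "(complex^'n) set"
  assumes K: "compact K" "K \<noteq> {}" "poly_hull K = K" and f: "holomorphic_near f K" and e: "e > 0"
  obtains q where "polyfun_cn q" "\<And>z. z \<in> K \<Longrightarrow> norm (f z - q z) < e"
proof -
  obtain U h where U: "open U" "K \<subseteq> U" "holomorphic_cn h U" "\<And>z. z \<in> K \<Longrightarrow> f z = h z"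
    using f unfolding holomorphic_near_def by blast
  define n where "n = CARD('n)"
  obtain idx :: "'n \<Rightarrow> nat" where idx: "bij_betw idx UNIV {0..<n}"
    using ex_bij_betw_finite_nat[of "UNIV :: 'n set"] by (auto simp: n_def)
  define \<pi> where "\<pi> = (\<lambda>x :: nat \<Rightarrow> complex. (\<chi> i. x (idx i)) :: complex^'n)"
  define \<iota> where "\<iota> = (\<lambda>(z :: complex^'n) k. if k < n then z $ (inv idx k) else 0)"
  have "inj idx" using idx by (simp add: bij_betw_def)
  moreover have "idx i < n" for i using idx by (auto simp: bij_betw_def)
  ultimately have \<pi>\<iota>: "\<pi> (\<iota> z) = z" for z
    by (simp add: \<pi>_def \<iota>_def vec_eq_iff)
  obtain r where r: "r > 0" "\<And>z. z \<in> K \<Longrightarrow> norm z \<le> r"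
    using compact_imp_bounded[OF K(1)] by (auto simp: bounded_pos)
  \<comment> \<open>Radius 0 freezes the coordinates beyond the dimension, which makes
    \<open>X\<close> a polydisc in the \<open>n\<close> variables and fits the hypothesis on
    \<open>R\<close> above.\<close>
  define R where "R = (\<lambda>k. if k < n then r else 0)"
  define X where "X = {x :: nat \<Rightarrow> complex. \<forall>i. x i \<in> cball 0 (R i)}"
  have X: "compact X" unfolding X_def by (rule compact_product) simp
  have \<iota>X: "\<iota> z \<in> X" if "z \<in> K" for z
  proof -
    have "norm (z $ i) \<le> r" for i by (rule order_trans[OF Finite_Cartesian_Product.norm_nth_le r(2)[OF that]])
    then show ?thesis by (auto simp: X_def \<iota>_def R_def)
  qed
  have c\<pi>: "continuous_on A \<pi>" for A unfolding \<pi>_def by (rule continuous_on_vec_of_fun)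
  have o\<pi>: "open (\<pi> -` U)" by (rule open_vimage[OF U(1) c\<pi>])
  define QQ where "QQ = {q :: complex^'n \<Rightarrow> complex. polyfun_cn q \<and> (\<forall>w\<in>K. norm (q w) \<le> 1)}"
  have sep: "\<exists>q\<in>QQ. norm (q z) > 1" if z: "z \<notin> K" for z
  proof -
    obtain q where q: "polyfun_cn q" "norm (q z) > (SUP w\<in>K. norm (q w))"
      using z K(3) unfolding poly_hull_def by force
    define s where "s = (SUP w\<in>K. norm (q w))"
    have "compact ((\<lambda>w. norm (q w)) ` K)"
      by (intro compact_continuous_image continuous_intros polyfun_cn_continuous q K(1))
    then have bdd: "bdd_above ((\<lambda>w. norm (q w)) ` K)" by (intro bounded_imp_bdd_above compact_imp_bounded)
    then have s: "norm (q w) \<le> s" if "w \<in> K" for w unfolding s_def using that by (rule cSUP_upper[rotated])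
    obtain w where "w \<in> K" using K(2) by blast
    then have "s \<ge> 0" using s[of w] norm_ge_zero[of "q w"] by linarith
    \<comment> \<open>The normalisation divides by \<open>t\<close> and not by \<open>s\<close>,
      which may be 0.\<close>
    obtain t where t: "s < t" "t < norm (q z)" using dense q(2) s_def by blast
    have t0: "t > 0" using t \<open>s \<ge> 0\<close> by linarith
    have "norm (of_real (1 / t) * q w) \<le> 1" if "w \<in> K" for w
      using s[OF that] t t0 by (simp add: norm_mult norm_divide)
    then have "(\<lambda>w. of_real (1 / t) * q w) \<in> QQ"
      unfolding QQ_def using q(1) polyfun_cn_mult[OF polyfun_cn_const] by blast
    moreover have "norm (of_real (1 / t) * q z) > 1" using t t0 by (simp add: norm_mult norm_divide)
    ultimately show ?thesis by (intro bexI[where x="\<lambda>w. of_real (1 / t) * q w"])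
  qed
  have "compact (X - \<pi> -` U)" by (intro compact_diff X o\<pi>)
  moreover have "open ((\<lambda>x. q (\<pi> x)) -` (- cball 0 1))" if "q \<in> QQ" for q
    by (intro open_vimage continuous_on_compose2[OF polyfun_cn_continuous[of q UNIV] c\<pi>]) (use that in \<open>auto simp: QQ_def\<close>)
  moreover have "X - \<pi> -` U \<subseteq> (\<Union>q\<in>QQ. (\<lambda>x. q (\<pi> x)) -` (- cball 0 1))"
  proof
    fix x assume "x \<in> X - \<pi> -` U"
    then have "\<pi> x \<notin> K" using U(2) by blast
    from sep[OF this] obtain q where "q \<in> QQ" "norm (q (\<pi> x)) > 1" by blast
    then show "x \<in> (\<Union>q\<in>QQ. (\<lambda>x. q (\<pi> x)) -` (- cball 0 1))" by (intro UN_I[of q]) auto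
  qed
  ultimately obtain Q0 where Q0: "Q0 \<subseteq> QQ" "finite Q0" "X - \<pi> -` U \<subseteq> (\<Union>q\<in>Q0. (\<lambda>x. q (\<pi> x)) -` (- cball 0 1))"
    by (rule compactE_image[where C=QQ])
  obtain Q where Q: "set Q = Q0" using finite_list[OF Q0(2)] by blast
  define Q' where "Q' = map (\<lambda>q x. q (\<pi> x)) Q"
  have "\<exists>p. polyn p \<and> (\<forall>x\<in>polyh (\<lambda>i. cball 0 (R i)) Q'. norm (h (\<pi> x) - p x) < e)"
  proof (rule oka_weil_polyhedron[of Q' R n "\<pi> -` U"])
    show "polyn q" if "q \<in> set Q'" for q
      using that Q Q0(1) polyfun_cn_polyn[of _ idx] by (auto simp: Q'_def QQ_def \<pi>_def)
    show "hol (\<lambda>x. h (\<pi> x)) (\<pi> -` U)"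
      using hol_cn[OF U(3), of idx] by (simp add: \<pi>_def vimage_def)
    show "polyh (\<lambda>i. cball 0 (R i)) Q' \<subseteq> \<pi> -` U"
    proof
      fix x assume x: "x \<in> polyh (\<lambda>i. cball 0 (R i)) Q'"
      then have "x \<in> X" by (simp add: polyh_def X_def)
      moreover have "norm (q (\<pi> x)) \<le> 1" if "q \<in> Q0" for q
        using x that Q by (auto simp: polyh_def Q'_def)
      ultimately show "x \<in> \<pi> -` U" using Q0(3) by fastforce
    qed
  qed (use r e o\<pi> in \<open>auto simp: R_def\<close>)
  then obtain p where p: "polyn p" "\<And>x. x \<in> polyh (\<lambda>i. cball 0 (R i)) Q' \<Longrightarrow> norm (h (\<pi> x) - p x) < e" by blast
  show thesis
  proof (rule that[of "\<lambda>z. p (\<iota> z)"])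
    have "polyfun_cn (\<lambda>z. \<iota> z k)" for k
      by (cases "k < n") (auto simp: \<iota>_def polyfun_cn_coord polyfun_cn_const)
    then show "polyfun_cn (\<lambda>z. p (\<iota> z))" by (rule polyn_polyfun_cn[OF p(1)])
    fix z assume z: "z \<in> K"
    have "\<iota> z \<in> polyh (\<lambda>i. cball 0 (R i)) Q'"
      using \<iota>X[OF z] Q Q0(1) z by (auto simp: polyh_def X_def Q'_def \<pi>\<iota> QQ_def)
    from p(2)[OF this] show "norm (f z - p (\<iota> z)) < e" using U(4)[OF z] by (simp add: \<pi>\<iota>)
  qed
qed

section \<open>Measurable selection\<close>

text \<open>Polynomials are coded by lists of pairs of a coefficient index and an exponent, a
  countable type because \<open>'n\<close> is finite; repeated exponents do no harm. Density follows
  by adjusting one coefficient after the other.\<close>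

lemma countable_dense_polyfun_cn:
  obtains P :: "nat \<Rightarrow> complex^'n \<Rightarrow> complex"
  where "\<And>m. polyfun_cn (P m)"
    "\<And>q K e. polyfun_cn q \<Longrightarrow> compact K \<Longrightarrow> e > 0 \<Longrightarrow> \<exists>m. \<forall>z\<in>K. norm (q z - P m z) < e"
proof -
  obtain D :: "complex set" where D: "countable D" "D \<subseteq> UNIV" "UNIV \<subseteq> closure D"
    by (rule separable)
  have "D \<noteq> {}" using D(3) by auto
  define d where "d = from_nat_into D"
  have dense: "\<exists>k. norm (c - d k) < \<eta>" if "\<eta> > 0" for c \<eta>
  proof -
    have "\<exists>x\<in>D. dist x c < \<eta>" using D(3) that closure_approachable[of c D] by auto
    then obtain x where "x \<in> D" "dist x c < \<eta>" by blast
    moreover obtain k where "d k = x" using from_nat_into_surj[OF D(1) \<open>x \<in> D\<close>] by (auto simp: d_def)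
    ultimately show ?thesis by (auto simp: dist_norm norm_minus_commute)
  qed
  define L where "L = (\<lambda>l z. \<Sum>(k, \<alpha>)\<leftarrow>l. d k * cn_monom \<alpha> (z :: complex^'n))"
  have polyL: "polyfun_cn (L l)" for l
    unfolding L_def by (induction l) (auto intro: polyfun_cn_const polyfun_cn_add polyfun_cn_monom)
  have approx: "\<exists>l. \<forall>z\<in>K. norm ((\<Sum>\<alpha>\<in>S. c \<alpha> * cn_monom \<alpha> z) - L l z) < e"
    if "finite S" "compact K" "e > 0" for S c e and K :: "(complex^'n) set"
    using that(1,3)
  proof (induction S arbitrary: e rule: finite_induct)
    case empty
    then show ?case by (intro exI[of _ "[]"]) (auto simp: L_def)
  next
    case (insert \<alpha> S)
    obtain l where l: "\<And>z. z \<in> K \<Longrightarrow> norm ((\<Sum>\<alpha>\<in>S. c \<alpha> * cn_monom \<alpha> z) - L l z) < e / 2"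
      using insert.IH[of "e / 2"] insert.prems by auto
    have "compact (cn_monom \<alpha> ` K)" by (intro compact_continuous_image continuous_on_cn_monom that(2))
    then obtain C where C: "C > 0" "\<And>z. z \<in> K \<Longrightarrow> norm (cn_monom \<alpha> z) \<le> C"
      by (auto dest!: compact_imp_bounded simp: bounded_pos)
    \<comment> \<open>\<open>C\<close> bounds the new monomial on \<open>K\<close>, so it adds at
      most \<open>e / 2\<close> to the error; the remaining monomials use the other half.\<close>
    obtain k where k: "norm (c \<alpha> - d k) < e / (2 * C)" using dense[of "e / (2 * C)"] C insert.prems by auto
    have "norm ((\<Sum>\<alpha>\<in>insert \<alpha> S. c \<alpha> * cn_monom \<alpha> z) - L ((k, \<alpha>) # l) z) < e" if z: "z \<in> K" for z
    proof -
      have "norm ((c \<alpha> - d k) * cn_monom \<alpha> z) \<le> e / (2 * C) * C"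
        unfolding norm_mult using k C z insert.prems by (intro mult_mono) auto
      then have "norm ((c \<alpha> - d k) * cn_monom \<alpha> z) \<le> e / 2" using C by simp
      then have "norm ((c \<alpha> - d k) * cn_monom \<alpha> z + ((\<Sum>\<alpha>\<in>S. c \<alpha> * cn_monom \<alpha> z) - L l z)) < e"
        using l[OF z] by (intro norm_triangle_lt) linarith
      moreover have "(\<Sum>\<alpha>\<in>insert \<alpha> S. c \<alpha> * cn_monom \<alpha> z) - L ((k, \<alpha>) # l) z =
          (c \<alpha> - d k) * cn_monom \<alpha> z + ((\<Sum>\<alpha>\<in>S. c \<alpha> * cn_monom \<alpha> z) - L l z)"
        using insert.hyps by (simp add: L_def algebra_simps)
      ultimately show ?thesis by simp
    qed
    then show ?case by blast
  qed
  show thesis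
  proof (rule that[of "\<lambda>m. L (from_nat m)"])
    show "polyfun_cn (L (from_nat m))" for m by (rule polyL)
    fix q :: "complex^'n \<Rightarrow> complex" and K :: "(complex^'n) set" and e assume q: "polyfun_cn q" and K: "compact K" "(e :: real) > 0"
    obtain S c where S: "finite S" "\<And>z. q z = (\<Sum>\<alpha>\<in>S. c \<alpha> * cn_monom \<alpha> z)"
      using q unfolding polyfun_cn_iff by blast
    obtain l where "\<And>z. z \<in> K \<Longrightarrow> norm (q z - L l z) < e"
      using approx[OF S(1) K, of c] S(2) by auto
    then show "\<exists>m. \<forall>z\<in>K. norm (q z - L (from_nat m) z) < e"
      by (intro exI[of _ "to_nat l"]) simp
  qed
qed

text \<open>A point of one set outside the other, which is closed, has positive distance from it;
  compactness bounds the supremum from which this is read off.\<close>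

lemma hausdorff_dist_pos:
  assumes S: "compact S" "S \<noteq> {}" and T: "compact T" "T \<noteq> {}" and "S \<noteq> T"
  shows "hausdorff_dist S T > 0"
proof -
  have pos: "(SUP x\<in>A. infdist x B) > 0" if A: "compact A" and B: "compact B" "B \<noteq> {}" and x: "x \<in> A" "x \<notin> B"
    for A B :: "'a set" and x
  proof -
    have "bdd_above ((\<lambda>x. infdist x B) ` A)"
      by (intro bounded_imp_bdd_above compact_imp_bounded compact_continuous_image A continuous_intros)
    then have "infdist x B \<le> (SUP x\<in>A. infdist x B)" using x(1) by (rule cSUP_upper[rotated])
    moreover have "infdist x B > 0" using B x(2) by (intro infdist_pos_not_in_closed compact_imp_closed)
    ultimately show ?thesis by linarith
  qed
  consider x where "x \<in> S" "x \<notin> T" | x where "x \<in> T" "x \<notin> S" using assms(5) by blast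
  then show ?thesis
    by cases (auto simp: hausdorff_dist_def less_max_iff_disj pos[OF S(1) T] pos[OF T(1) S])
qed

text \<open>Makes the event that \<open>K\<close> takes a given value measurable. The complement is
  open, since the ball around \<open>T\<close> of radius \<open>hausdorff_dist T S\<close> misses
  \<open>S\<close>.\<close>

lemma singleton_in_compact_sets_borel:
  assumes "S \<in> compact_sets"
  shows "{S} \<in> sets compact_sets_borel"
proof -
  have sub: "{U :: 'a set set. hausdorff_open U} \<subseteq> Pow compact_sets" by (auto simp: hausdorff_open_def)
  have "hausdorff_open (compact_sets - {S})"
    unfolding hausdorff_open_def
  proof (intro conjI ballI)
    fix T assume T: "T \<in> compact_sets - {S}"
    then have "hausdorff_dist T S > 0" using assms by (auto simp: compact_sets_def intro: hausdorff_dist_pos)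
    then show "\<exists>e>0. \<forall>T'\<in>compact_sets. hausdorff_dist T T' < e \<longrightarrow> T' \<in> compact_sets - {S}"
      by (intro exI[of _ "hausdorff_dist T S"]) auto
  qed auto
  then have "compact_sets - {S} \<in> sets compact_sets_borel"
    unfolding compact_sets_borel_def using sub by (simp add: sets_measure_of sigma_sets.Basic)
  then have "space compact_sets_borel - (compact_sets - {S}) \<in> sets (compact_sets_borel :: 'a set measure)" by (rule sets.compl_sets)
  moreover have "space compact_sets_borel = (compact_sets :: 'a set set)"
    unfolding compact_sets_borel_def using sub by (simp add: space_measure_of)
  moreover have "compact_sets - (compact_sets - {S}) = {S}" using assms by auto
  ultimately show ?thesis by simp
qed

theorem theorem7p8:
  fixes M :: "'a measure"
    and K :: "'a \<Rightarrow> (complex^'n) set"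
    and \<epsilon> :: "'a \<Rightarrow> real"
    and f :: "'a \<Rightarrow> complex^'n \<Rightarrow> complex"
  assumes "sigma_finite_measure M"
    and "K \<in> M \<rightarrow>\<^sub>M compact_sets_borel"
    and "countable (K ` space M)"
    and "\<forall>\<omega>\<in>space M. poly_hull (K \<omega>) = K \<omega>"
    and "\<epsilon> \<in> borel_measurable M"
    and "\<forall>\<omega>\<in>space M. \<epsilon> \<omega> > 0"
    and "gen_random_fun M K f"
    and "\<forall>\<omega>\<in>space M. holomorphic_near (f \<omega>) (K \<omega>)"
  shows "\<exists>p L. gen_random_poly M K p \<and> L \<in> null_sets M \<and>
           (\<forall>\<omega>\<in>space M - L. (SUP z\<in>K \<omega>. norm (p \<omega> z - f \<omega> z)) < \<epsilon> \<omega>)"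
proof -
  have spK: "space (compact_sets_borel :: (complex^'n) set measure) = compact_sets"
    unfolding compact_sets_borel_def by (rule space_measure_of) (auto simp: hausdorff_open_def)
  have Kc: "compact (K \<omega>)" "K \<omega> \<noteq> {}" if "\<omega> \<in> space M" for \<omega>
    using measurable_space[OF assms(2) that] by (auto simp: spK compact_sets_def)
  obtain P :: "nat \<Rightarrow> complex^'n \<Rightarrow> complex" where P: "\<And>m. polyfun_cn (P m)"
    "\<And>q K e. polyfun_cn q \<Longrightarrow> compact K \<Longrightarrow> e > 0 \<Longrightarrow> \<exists>m. \<forall>z\<in>K. norm (q z - P m z) < e"
    using countable_dense_polyfun_cn by metis
  have "\<forall>S :: (complex^'n) set. \<exists>D. countable D \<and> D \<subseteq> S \<and> S \<subseteq> closure D"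
    using separable by metis
  then obtain D where D: "\<And>S. countable (D S)" "\<And>S. D S \<subseteq> S" "\<And>S :: (complex^'n) set. S \<subseteq> closure (D S)" by metis
  \<comment> \<open>The weak inequality passes from the dense subset to all of
    \<open>K \<omega>\<close>, and the half leaves room for a supremum strictly below
    \<open>\<epsilon> \<omega>\<close>.\<close>
  define good where "good = (\<lambda>m \<omega>. \<forall>z\<in>D (K \<omega>). norm (P m z - f \<omega> z) \<le> \<epsilon> \<omega> / 2)"
  have ex: "\<exists>m. good m \<omega>" if \<omega>: "\<omega> \<in> space M" for \<omega>
  proof -
    \<comment> \<open>One quarter is spent on Oka--Weil, one on replacing the polynomial by a member
      of \<open>P\<close>.\<close>
    have e: "\<epsilon> \<omega> / 4 > 0" using assms(6) \<omega> by auto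
    obtain q where q: "polyfun_cn q" "\<And>z. z \<in> K \<omega> \<Longrightarrow> norm (f \<omega> z - q z) < \<epsilon> \<omega> / 4"
      by (rule oka_weil[OF Kc[OF \<omega>] _ _ e]) (use assms(4,8) \<omega> in auto)
    obtain m where m: "\<And>z. z \<in> K \<omega> \<Longrightarrow> norm (q z - P m z) < \<epsilon> \<omega> / 4"
      using P(2)[OF q(1) Kc(1)[OF \<omega>] e] by blast
    have "norm (P m z - f \<omega> z) \<le> \<epsilon> \<omega> / 2" if "z \<in> K \<omega>" for z
      using q(2)[OF that] m[OF that] norm_triangle_ineq[of "f \<omega> z - q z" "q z - P m z"]
      by (simp add: norm_minus_commute)
    then show ?thesis using D(2) unfolding good_def by blast
  qed
  have meas: "Measurable.pred M (good m)" for m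
  proof -
    \<comment> \<open>Splitting by the value \<open>S\<close> of \<open>K\<close> replaces test
      points depending on \<omega> by the fixed countable set \<open>D S\<close>.\<close>
    have "{\<omega>\<in>space M. good m \<omega>} = (\<Union>S\<in>K ` space M. {\<omega>\<in>space M. K \<omega> = S \<and> (\<forall>z\<in>D S. norm (P m z - f \<omega> z) \<le> \<epsilon> \<omega> / 2)})"
      by (auto simp: good_def)
    also have "\<dots> \<in> sets M"
    proof (rule sets.countable_UN'[OF assms(3)], safe)
      fix \<omega>0 assume \<omega>0: "\<omega>0 \<in> space M"
      define S where "S = K \<omega>0"
      define A where "A = {\<omega>\<in>space M. K \<omega> = S}"
      have "S \<in> compact_sets" using Kc[OF \<omega>0] by (simp add: S_def compact_sets_def)
      from measurable_sets[OF assms(2) singleton_in_compact_sets_borel[OF this]]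
      have A: "A \<in> sets M" by (simp add: A_def vimage_def Int_def conj_commute)
      have "{\<omega>\<in>A. norm (P m z - f \<omega> z) \<le> \<epsilon> \<omega> / 2} \<in> sets M" if z: "z \<in> D S" for z
      proof -
        have zS: "z \<in> S" using z D(2) by blast
        \<comment> \<open>Measurability of \<open>f\<close> at \<open>z\<close> is granted only
          where \<open>z\<close> belongs to \<open>K \<omega>\<close>, which holds throughout
          \<open>A\<close>.\<close>
        have sub: "A \<subseteq> preimg M K z" using zS by (auto simp: A_def preimg_def)
        have "preimg M K z \<noteq> {}" using zS \<omega>0 by (auto simp: preimg_def S_def)
        then have "(\<lambda>\<omega>. f \<omega> z) \<in> borel_measurable (restrict_space M (preimg M K z))"
          using assms(7) by (simp add: gen_random_fun_def)
        then have [measurable]: "(\<lambda>\<omega>. f \<omega> z) \<in> borel_measurable (restrict_space M A)"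
          by (rule measurable_restrict_mono[OF _ sub])
        have [measurable]: "\<epsilon> \<in> borel_measurable (restrict_space M A)"
          using assms(5) by (rule measurable_restrict_space1)
        have "{\<omega>\<in>space (restrict_space M A). norm (P m z - f \<omega> z) \<le> \<epsilon> \<omega> / 2} \<in> sets (restrict_space M A)"
          by measurable
        moreover have "space (restrict_space M A) = A" using A by (simp add: space_restrict_space2)
        ultimately show ?thesis using A by (simp add: sets_restrict_space_iff sets.Int_space_eq2)
      qed
      then have "(\<Inter>z\<in>D S. {\<omega>\<in>A. norm (P m z - f \<omega> z) \<le> \<epsilon> \<omega> / 2}) \<in> sets M"
        using D(1,3)[of S] Kc(2)[OF \<omega>0] by (intro sets.countable_INT') (auto simp: S_def)
      moreover have "(\<Inter>z\<in>D S. {\<omega>\<in>A. norm (P m z - f \<omega> z) \<le> \<epsilon> \<omega> / 2}) =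
          {\<omega>\<in>space M. K \<omega> = S \<and> (\<forall>z\<in>D S. norm (P m z - f \<omega> z) \<le> \<epsilon> \<omega> / 2)}"
      proof -
        have "D S \<noteq> {}" using D(3)[of S] Kc(2)[OF \<omega>0] by (auto simp: S_def)
        then show ?thesis by (auto simp: A_def)
      qed
      ultimately show "{\<omega>\<in>space M. K \<omega> = K \<omega>0 \<and> (\<forall>z\<in>D (K \<omega>0). norm (P m z - f \<omega> z) \<le> \<epsilon> \<omega> / 2)} \<in> sets M"
        by (simp add: S_def)
    qed
    finally show ?thesis by (simp add: pred_def)
  qed
  define N where "N = (\<lambda>\<omega>. LEAST m. good m \<omega>)"
  have N: "N \<in> measurable M (count_space UNIV)" unfolding N_def by (rule measurable_Least[OF meas])
  have goodN: "good (N \<omega>) \<omega>" if "\<omega> \<in> space M" for \<omega>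
    using ex[OF that] unfolding N_def by (auto intro: LeastI)
  define p where "p = (\<lambda>\<omega>. P (N \<omega>))"
  \<comment> \<open>For fixed \<open>z\<close> the value depends on \<omega> only through the
    integer \<open>N \<omega>\<close>, and every function on a discrete space is measurable.\<close>
  have "(\<lambda>\<omega>. p \<omega> z) \<in> borel_measurable M" for z
    unfolding p_def by (rule measurable_compose[OF N]) simp
  then have "gen_random_poly M K p"
    unfolding gen_random_poly_def gen_random_fun_def
    by (intro conjI allI impI ballI measurable_restrict_space1 exI[of _ "p _"]) (auto simp: p_def P(1))
  moreover have "(SUP z\<in>K \<omega>. norm (p \<omega> z - f \<omega> z)) < \<epsilon> \<omega>" if \<omega>: "\<omega> \<in> space M" for \<omega>
  proof -
    obtain U h where U: "K \<omega> \<subseteq> U" "holomorphic_cn h U" "\<forall>z\<in>K \<omega>. f \<omega> z = h z"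
      using assms(8)[rule_format, OF \<omega>] unfolding holomorphic_near_def by blast
    have "continuous_on U h"
      using U(2) unfolding holomorphic_cn_def
      by (meson continuous_at_imp_continuous_on has_derivative_continuous)
    then have "continuous_on (K \<omega>) h" using U(1) by (rule continuous_on_subset)
    then have cf: "continuous_on (K \<omega>) (f \<omega>)" using U(3) continuous_on_cong[of "K \<omega>" "K \<omega>" "f \<omega>" h] by simp
    have cl: "closure (D (K \<omega>)) = K \<omega>"
      using D(2,3)[of "K \<omega>"] Kc(1)[OF \<omega>] by (simp add: closure_minimal compact_imp_closed subset_antisym)
    have "norm (p \<omega> z - f \<omega> z) \<le> \<epsilon> \<omega> / 2" if "z \<in> K \<omega>" for z
    proof (rule continuous_le_on_closure[where S="D (K \<omega>)"])
      show "continuous_on (closure (D (K \<omega>))) (\<lambda>z. norm (p \<omega> z - f \<omega> z))"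
        unfolding cl p_def by (intro continuous_intros cf polyfun_cn_continuous P(1))
    qed (use that cl goodN[OF \<omega>] in \<open>auto simp: good_def p_def\<close>)
    then have "(SUP z\<in>K \<omega>. norm (p \<omega> z - f \<omega> z)) \<le> \<epsilon> \<omega> / 2"
      by (intro cSUP_least Kc(2)[OF \<omega>])
    also have "\<dots> < \<epsilon> \<omega>" using assms(6) \<omega> by auto
    finally show ?thesis .
  qed
  ultimately show ?thesis by (intro exI[of _ p] exI[of _ "{}"]) auto
qed

end
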